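(* Let $s>0$ and let $f:\mathbb{R}^n\to\mathbb{R}_+$ be an upper semi-continuous $s$-concave function, with corresponding convex function $\psi=\frac{1-f^s}{s}$ on $S_f=\{f>0\}$. Assume that $0$ belongs to the interior of $S_f$. Let $\lambda\in\mathbb{R}$. Then $$as^{(s)}_{1-\lambda}\bigl(\psi^\star_{(s)}\bigr)=as^{(s)}_\lambda(\psi).$$
   Context: A function $f:\mathbb{R}^n\to\mathbb{R}_+$ is $s$-concave ($s>0$) if $f((1-\lambda)x+\lambda y)\ge((1-\lambda)f(x)^s+\lambda f(y)^s)^{1/s}$ for all $\lambda\in[0,1]$ and all $x,y$ with $f(x)>0$, $f(y)>0$. Let $S_f=\{x:f(x)>0\}$, a convex set. The associated convex function is $$\psi(x)=\frac{1-f^s(x)}{s},\quad x\in S_f,$$ so $1-s\psi>0$ on $S_f$. Its $(s)$-dual is $$\psi^\star_{(s)}(y)=\sup_{x\in S_f}\frac{\langle x,y\rangle-\psi(x)}{1-s\psi(x)}.$$ The $(s)$-Legendre dual of $f$ is $f^\circ_{(s)}(y)=\inf_{x\in S_f}\frac{(1-s\langle x,y\rangle)_+^{1/s}}{f(x)}$, where $a_+=\max\{a,0\}$; it satisfies $f^\circ_{(s)}(y)=(1-s\psi^\star_{(s)}(y))^{1/s}$ on $S_{f^\circ_{(s)}}=\{y:1-s\psi^\star_{(s)}(y)>0\}$. Thus $\psi^\star_{(s)}$, considered on $S_{f^\circ_{(s)}}$, is the convex function associated with the $s$-concave function $f^\circ_{(s)}$. For such a convex function $\psi$ (associated with an $s$-concave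 function $f$), $X_\psi$ is the set of points in the interior of $S_f$ at which the Hessian $\nabla^2\psi$ in the sense of Alexandrov exists and is invertible (and similarly for $\psi^\star_{(s)}$ with $S_{f^\circ_{(s)}}$), and for $\lambda\in\mathbb{R}$, $$as^{(s)}_\lambda(\psi)=\frac1{1+ns}\int_{X_\psi}\frac{(1-s\psi(x))^{(\frac1s-1)(1-\lambda)}\,(\det\nabla^2\psi(x))^\lambda}{\bigl(1+s(\langle x,\nabla\psi(x)\rangle-\psi(x))\bigr)^{\lambda(n+\frac1s+1)-1}}\,dx.$$ *)

theory Defs
  imports "HOL-Analysis.Analysis"
begin

definition pos_set :: "('a \<Rightarrow> real) \<Rightarrow> 'a set" where
  "pos_set f = {x. f x > 0}"

definition s_concave :: "real \<Rightarrow> ('a::real_vector \<Rightarrow> real) \<Rightarrow> bool" where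
  "s_concave s f \<longleftrightarrow>
     (\<forall>x y. \<forall>t\<in>{0..1}. f x > 0 \<longrightarrow> f y > 0 \<longrightarrow>
        f ((1 - t) *\<^sub>R x + t *\<^sub>R y) \<ge> ((1 - t) * f x powr s + t * f y powr s) powr (1 / s))"

definition upper_semicontinuous :: "('a::topological_space \<Rightarrow> real) \<Rightarrow> bool" where
  "upper_semicontinuous f \<longleftrightarrow> (\<forall>x c. f x < c \<longrightarrow> (\<forall>\<^sub>F y in nhds x. f y < c))"

text \<open>Meaningful on \<open>pos_set f\<close> only; it is always paired with that domain.\<close>

definition assoc_convex :: "real \<Rightarrow> ('a \<Rightarrow> real) \<Rightarrow> 'a \<Rightarrow> real" where
  "assoc_convex s f x = (1 - f x powr s) / s"

text \<open>The domain \<open>S\<close> of \<open>\<psi>\<close> is explicit. The supremum may be infinite, hence \<open>ereal\<close>.\<close>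

definition s_dual :: "real \<Rightarrow> 'a::real_inner set \<Rightarrow> ('a \<Rightarrow> real) \<Rightarrow> 'a \<Rightarrow> ereal" where
  "s_dual s S \<psi> y = (SUP x\<in>S. ereal ((x \<bullet> y - \<psi> x) / (1 - s * \<psi> x)))"

definition legendre_dual :: "real \<Rightarrow> ('a::real_inner \<Rightarrow> real) \<Rightarrow> 'a \<Rightarrow> real" where
  "legendre_dual s f y = (INF x\<in>pos_set f. max (1 - s * (x \<bullet> y)) 0 powr (1 / s) / f x)"

definition gradient :: "('a::real_inner \<Rightarrow> real) \<Rightarrow> 'a \<Rightarrow> 'a" where
  "gradient \<phi> x = (THE p. GDERIV \<phi> x :> p)"

text \<open>
  The Hessian in the sense of Alexandrov is the symmetric matrix in a second-order Taylor
  expansion at the point; differentiability at neighbouring points is not required.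
  Symmetry makes the matrix unique.
\<close>

definition has_alexandrov_hessian ::
    "(real ^ 'n \<Rightarrow> real) \<Rightarrow> real ^ 'n ^ 'n \<Rightarrow> real ^ 'n \<Rightarrow> bool" where
  "has_alexandrov_hessian \<phi> A x \<longleftrightarrow> transpose A = A \<and>
     (\<exists>p. GDERIV \<phi> x :> p \<and>
        ((\<lambda>h. (\<phi> (x + h) - \<phi> x - p \<bullet> h - (h \<bullet> (A *v h)) / 2) / (norm h)\<^sup>2) \<longlongrightarrow> 0) (at 0))"

definition hessian :: "(real ^ 'n \<Rightarrow> real) \<Rightarrow> real ^ 'n \<Rightarrow> real ^ 'n ^ 'n" where
  "hessian \<phi> x = (THE A. has_alexandrov_hessian \<phi> A x)"

definition nondegenerate_points :: "(real ^ 'n) set \<Rightarrow> (real ^ 'n \<Rightarrow> real) \<Rightarrow> (real ^ 'n) set" where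
  "nondegenerate_points S \<psi> =
     {x \<in> interior S. \<exists>A. has_alexandrov_hessian \<psi> A x \<and> invertible A}"

text \<open>
  The integrand is nonnegative and the integral may be infinite, so the value lies in
  \<open>[0, \<infinity>]\<close>. For the convex functions considered, all bases of the real powers are
  strictly positive on \<open>nondegenerate_points S \<psi>\<close>.
\<close>

definition affine_surface_area ::
    "real \<Rightarrow> real \<Rightarrow> (real ^ 'n) set \<Rightarrow> (real ^ 'n \<Rightarrow> real) \<Rightarrow> ennreal" where
  "affine_surface_area s l S \<psi> =
     ennreal (1 / (1 + real CARD('n) * s)) *
     set_nn_integral lebesgue (nondegenerate_points S \<psi>)
       (\<lambda>x. ennreal
          ((1 - s * \<psi> x) powr ((1 / s - 1) * (1 - l)) * det (hessian \<psi> x) powr l /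
           (1 + s * (x \<bullet> gradient \<psi> x - \<psi> x)) powr (l * (real CARD('n) + 1 / s + 1) - 1)))"

text \<open>
  The two duals are consistent: the positivity set of \<open>legendre_dual s f\<close> is where
  \<open>1 - s \<psi>\<^sup>\<star> > 0\<close>, the dual \<open>\<psi>\<^sup>\<star>\<close> is finite there, and there it is the convex function
  associated with \<open>legendre_dual s f\<close>.
\<close>

lemma s_dual_le_of_legendre_dual_pos:
  fixes f :: "'a::real_inner \<Rightarrow> real"
  assumes s: "s > 0" and pos: "legendre_dual s f y > 0"
  shows "s_dual s (pos_set f) (assoc_convex s f) y \<le> ereal ((1 - legendre_dual s f y powr s) / s)"
  unfolding s_dual_def
proof (rule SUP_least)
  fix x assume x: "x \<in> pos_set f"
  define c where "c = legendre_dual s f y"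
  have fx: "f x > 0" using x by (simp add: pos_set_def)
  have bdd: "bdd_below ((\<lambda>x. max (1 - s * (x \<bullet> y)) 0 powr (1 / s) / f x) ` pos_set f)"
    by (rule bdd_belowI2[of _ 0]) (auto simp: pos_set_def)
  have "c \<le> max (1 - s * (x \<bullet> y)) 0 powr (1 / s) / f x"
    unfolding c_def legendre_dual_def by (rule cINF_lower[OF bdd x])
  hence le: "c * f x \<le> max (1 - s * (x \<bullet> y)) 0 powr (1 / s)"
    using fx by (simp add: field_simps)
  have cf: "c * f x > 0" using pos fx by (simp add: c_def)
  have gt: "1 - s * (x \<bullet> y) > 0"
    using le cf by (cases "1 - s * (x \<bullet> y) > 0") (auto simp: max_def)
  have "(c * f x) powr s \<le> (max (1 - s * (x \<bullet> y)) 0 powr (1 / s)) powr s"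
    using le cf s by (intro powr_mono2) auto
  hence "c powr s * f x powr s \<le> 1 - s * (x \<bullet> y)"
    using gt s pos fx by (simp add: powr_powr powr_mult c_def)
  hence "(x \<bullet> y - assoc_convex s f x) / (1 - s * assoc_convex s f x) \<le> (1 - c powr s) / s"
  proof -
    assume *: "c powr s * f x powr s \<le> 1 - s * (x \<bullet> y)"
    have "s * ((x \<bullet> y - assoc_convex s f x) / (1 - s * assoc_convex s f x))
          = 1 - (1 - s * (x \<bullet> y)) / f x powr s"
      using s fx by (simp add: assoc_convex_def field_simps)
    also have "\<dots> \<le> 1 - c powr s" using * fx by (simp add: field_simps)
    finally show ?thesis using s by (simp add: field_simps)
  qed
  thus "ereal ((x \<bullet> y - assoc_convex s f x) / (1 - s * assoc_convex s f x))
        \<le> ereal ((1 - legendre_dual s f y powr s) / s)"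
    by (simp add: c_def)
qed

lemma legendre_dual_ge_of_s_dual:
  fixes f :: "'a::real_inner \<Rightarrow> real"
  assumes s: "s > 0" and ne: "pos_set f \<noteq> {}"
    and d: "s_dual s (pos_set f) (assoc_convex s f) y = ereal d" "1 - s * d > 0"
  shows "(1 - s * d) powr (1 / s) \<le> legendre_dual s f y"
  unfolding legendre_dual_def
proof (rule cINF_greatest[OF ne])
  fix x assume x: "x \<in> pos_set f"
  have fx: "f x > 0" using x by (simp add: pos_set_def)
  have "ereal ((x \<bullet> y - assoc_convex s f x) / (1 - s * assoc_convex s f x)) \<le> ereal d"
    unfolding d(1)[symmetric] s_dual_def by (rule SUP_upper[OF x])
  hence le: "(1 - s * d) * f x powr s \<le> 1 - s * (x \<bullet> y)"
    using s fx by (simp add: assoc_convex_def field_simps)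
  have "((1 - s * d) * f x powr s) powr (1 / s) \<le> (1 - s * (x \<bullet> y)) powr (1 / s)"
    using le d s fx by (intro powr_mono2) auto
  hence *: "(1 - s * d) powr (1 / s) * f x \<le> (1 - s * (x \<bullet> y)) powr (1 / s)"
    using s fx d by (simp add: powr_mult powr_powr)
  have "0 < (1 - s * d) * f x powr s" using d fx by simp
  with le have "max (1 - s * (x \<bullet> y)) 0 = 1 - s * (x \<bullet> y)" by simp
  with * show "(1 - s * d) powr (1 / s) \<le> max (1 - s * (x \<bullet> y)) 0 powr (1 / s) / f x"
    using fx by (simp add: field_simps)
qed

lemma s_dual_not_MInf:
  assumes "pos_set f \<noteq> {}"
  shows "s_dual s (pos_set f) (assoc_convex s f) y \<noteq> -\<infinity>"
proof -
  obtain x where x: "x \<in> pos_set f" using assms by blast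
  have "ereal ((x \<bullet> y - assoc_convex s f x) / (1 - s * assoc_convex s f x))
        \<le> s_dual s (pos_set f) (assoc_convex s f) y"
    unfolding s_dual_def by (rule SUP_upper[OF x])
  thus ?thesis by auto
qed

lemma s_dual_real_of_legendre_dual_pos:
  assumes s: "s > 0" and ne: "pos_set f \<noteq> {}" and pos: "legendre_dual s f y > 0"
  shows "s_dual s (pos_set f) (assoc_convex s f) y = ereal (assoc_convex s (legendre_dual s f) y)"
proof -
  note le = s_dual_le_of_legendre_dual_pos[OF s pos]
  obtain d where d: "s_dual s (pos_set f) (assoc_convex s f) y = ereal d"
    using le s_dual_not_MInf[OF ne, of s y]
    by (cases "s_dual s (pos_set f) (assoc_convex s f) y") auto
  have 1: "legendre_dual s f y powr s \<le> 1 - s * d"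
    using le s by (simp add: d field_simps)
  moreover have p: "0 < legendre_dual s f y powr s" using pos by simp
  ultimately have d0: "1 - s * d > 0" by linarith
  have "((1 - s * d) powr (1 / s)) powr s \<le> legendre_dual s f y powr s"
    using legendre_dual_ge_of_s_dual[OF s ne d d0] s by (intro powr_mono2) auto
  hence "1 - s * d \<le> legendre_dual s f y powr s"
    using s d0 by (simp add: powr_powr)
  with 1 have "legendre_dual s f y powr s = 1 - s * d" by simp
  thus ?thesis using s by (simp add: d assoc_convex_def)
qed

lemma pos_set_legendre_dual:
  assumes s: "s > 0" and ne: "pos_set f \<noteq> {}"
  shows "pos_set (legendre_dual s f) =
    {y. 1 - ereal s * s_dual s (pos_set f) (assoc_convex s f) y > 0}"
proof (intro set_eqI iffI; unfold mem_Collect_eq)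
  fix y assume "y \<in> pos_set (legendre_dual s f)"
  hence p: "legendre_dual s f y > 0" by (simp add: pos_set_def)
  show "1 - ereal s * s_dual s (pos_set f) (assoc_convex s f) y > 0"
    using s p by (simp add: s_dual_real_of_legendre_dual_pos[OF s ne p] assoc_convex_def one_ereal_def)
next
  fix y assume *: "1 - ereal s * s_dual s (pos_set f) (assoc_convex s f) y > 0"
  obtain d where d: "s_dual s (pos_set f) (assoc_convex s f) y = ereal d"
    using * s s_dual_not_MInf[OF ne, of s y]
    by (cases "s_dual s (pos_set f) (assoc_convex s f) y") (auto simp: one_ereal_def)
  have d0: "1 - s * d > 0" using * by (simp add: d one_ereal_def)
  have "0 < (1 - s * d) powr (1 / s)" using d0 by simp
  thus "y \<in> pos_set (legendre_dual s f)"
    using legendre_dual_ge_of_s_dual[OF s ne d d0] unfolding pos_set_def mem_Collect_eq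
    by (rule less_le_trans)
qed

end

theory Submission
  imports Defs
begin

text \<open>
  Write \<open>g = f powr s = 1 - s \<psi>\<close> and \<open>\<eta>\<close> for the dual function of \<open>\<psi>\<close>, which is the convex
  function associated with \<open>legendre_dual s f\<close>. The duality is polarity of the region
  below the graph of \<open>g\<close>: the pair \<open>(\<psi>, \<eta>)\<close> satisfies \<open>x \<bullet> y + s \<psi>(x) \<eta>(y) \<le> \<psi>(x) + \<eta>(y)\<close>,
  and \<open>\<eta>(y)\<close> is the least number with this property for all \<open>x\<close>. At a point \<open>x\<close> with
  gradient \<open>v\<close> and support value \<open>m = 1 + s (x \<bullet> v - \<psi>(x))\<close>, equality holds for
  \<open>y = T(x) = v / m\<close>. The identity is the change of variables \<open>y = T(x)\<close>.

  The lemma \<open>dual_expands_at\<close> shows that, if \<open>\<psi>\<close> has an invertible Hessian \<open>M\<close> in the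
  sense of Alexandrov at \<open>x\<close>, then \<open>\<eta>\<close> has one at \<open>T(x)\<close>, with determinant
  \<open>(m / g)\<^sup>n\<^sup>+\<^sup>2 / det M\<close>, and that the gradient there is \<open>x / g\<close>, so that the same
  construction for \<open>\<eta>\<close> leads back to \<open>x\<close>. Conversely, the nondegenerate points of \<open>\<eta>\<close> are
  reached because of the bipolar theorem \<open>legendre_dual_legendre_dual\<close> and because \<open>m\<close> is
  positive at every nondegenerate point (\<open>support_value_pos\<close>), even where the dual fails
  to be positive at the origin. Hence \<open>T\<close> is a bijection between the sets of nondegenerate
  points.

  Subgradients inherit a first-order expansion from a second-order expansion of the
  function (\<open>has_derivative_subgradient\<close>), so \<open>T\<close> is differentiable relative to the set of
  nondegenerate points, with Jacobian determinant \<open>g det M / m\<^sup>n\<^sup>+\<^sup>1\<close>. This relative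
  derivative is all that a change of variables needs, and
  \<open>nn_integral_change_of_variables\<close> holds for arbitrary sets and integrands. So neither
  Alexandrov's theorem on almost everywhere differentiability nor measurability of the
  nondegenerate points enters. What remains is a count of exponents (\<open>density_exponents\<close>).
\<close>

section \<open>Change of variables for nonnegative integrals over arbitrary sets\<close>

lemma nn_integral_absolutely_integrable:
  fixes f :: "'a::euclidean_space \<Rightarrow> real"
  assumes "f absolutely_integrable_on S" and "\<And>x. x \<in> S \<Longrightarrow> 0 \<le> f x"
  shows "(\<integral>\<^sup>+x. ennreal (f x) * indicator S x \<partial>lebesgue) = ennreal (integral S f)"
proof -
  have "(\<integral>\<^sup>+x. ennreal (f x) * indicator S x \<partial>lebesgue)
      = (\<integral>\<^sup>+x. ennreal (indicator S x *\<^sub>R f x) \<partial>lebesgue)"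
    by (rule nn_integral_cong) (simp split: split_indicator)
  also have "\<dots> = ennreal (LINT x:S|lebesgue. f x)"
    unfolding set_lebesgue_integral_def
    by (rule nn_integral_eq_integral)
      (use assms in \<open>auto simp: set_integrable_def split: split_indicator\<close>)
  also have "\<dots> = ennreal (integral S f)"
    using set_lebesgue_integral_eq_integral(2)[OF assms(1)] by simp
  finally show ?thesis .
qed

text \<open>
  One inequality of the change of variables, with no measurability assumed of \<open>X\<close>, \<open>Y\<close>,
  \<open>F\<close> or \<open>G\<close>. The integral on the left is a supremum over simple functions below the
  integrand, and each of these is supported on a measurable subset of \<open>X\<close>, to which the
  classical theorem for Lebesgue measurable sets and one-sided (within the set)
  derivatives applies.
\<close>

lemma nn_integral_le_change_of_variables_wellorder:
  fixes T U :: "real ^ 'm::{finite,wellorder} \<Rightarrow> real ^ 'm::_"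
    and F G :: "real ^ 'm::{finite,wellorder} \<Rightarrow> ennreal"
  assumes derT: "\<And>x. x \<in> X \<Longrightarrow> (T has_derivative T' x) (at x within X)"
    and derU: "\<And>y. y \<in> Y \<Longrightarrow> (U has_derivative U' y) (at y within Y)"
    and TX: "\<And>x. x \<in> X \<Longrightarrow> T x \<in> Y" and UT: "\<And>x. x \<in> X \<Longrightarrow> U (T x) = x"
    and le: "\<And>x. x \<in> X \<Longrightarrow> F x * ennreal \<bar>det (matrix (U' (T x)))\<bar> \<le> G (T x)"
  shows "(\<integral>\<^sup>+x. F x * indicator X x \<partial>lebesgue) \<le> (\<integral>\<^sup>+y. G y * indicator Y y \<partial>lebesgue)"
  unfolding nn_integral_def_finite[of lebesgue "\<lambda>x. F x * indicator X x"]
proof (rule SUP_least)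
  fix u
  assume "u \<in> {u. simple_function lebesgue u \<and> u \<le> (\<lambda>x. F x * indicator X x) \<and> (\<forall>x. u x < top)}"
  then have u: "simple_function lebesgue u" and uF: "\<And>x. u x \<le> F x * indicator X x"
    and utop: "\<And>x. u x < top" by (auto simp: le_fun_def)
  have um [measurable]: "u \<in> borel_measurable lebesgue"
    using u by (rule borel_measurable_simple_function)
  define v where "v = (\<lambda>x. enn2real (u x))"
  have uv: "u x = ennreal (v x)" for x using utop by (simp add: v_def)
  have v0: "v x \<ge> 0" for x by (simp add: v_def)
  have vm [measurable]: "v \<in> borel_measurable lebesgue" unfolding v_def by measurable
  have "finite (range v)"
  proof -
    have "finite (u ` space lebesgue)" using u by (rule simple_functionD)
    then have "finite (enn2real ` u ` UNIV)" by simp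
    moreover have "range v = enn2real ` u ` UNIV" by (auto simp: v_def)
    ultimately show ?thesis by simp
  qed
  then obtain B where B: "\<And>x. \<bar>v x\<bar> \<le> B"
    by (metis bounded_iff finite_imp_bounded rangeI real_norm_def)
  \<comment> \<open>Truncation to balls makes the simple function integrable, as its support may have infinite measure.\<close>
  define P where "P k = {x. u x \<noteq> 0} \<inter> ball 0 (real k)" for k
  have PX: "P k \<subseteq> X" for k
  proof
    fix x assume "x \<in> P k"
    then have "u x \<noteq> 0" by (simp add: P_def)
    then show "x \<in> X" using uF[of x] by (cases "x \<in> X") auto
  qed
  have Pm [measurable]: "P k \<in> sets lebesgue" for k
  proof -
    have "{x \<in> space lebesgue. u x \<noteq> 0} \<in> sets lebesgue" by measurable
    then have "{x. u x \<noteq> 0} \<in> sets lebesgue" by simp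
    then show ?thesis unfolding P_def by (rule sets.Int) (simp add: fmeasurableD)
  qed
  have Plm: "P k \<in> lmeasurable" for k
  proof -
    have "bounded (P k)"
      by (rule bounded_subset[OF bounded_ball[of 0 "real k"]]) (auto simp: P_def)
    then show ?thesis using Pm by (rule bounded_set_imp_lmeasurable)
  qed
  have bound: "(\<integral>\<^sup>+x. u x * indicator (P k) x \<partial>lebesgue) \<le> (\<integral>\<^sup>+y. G y * indicator Y y \<partial>lebesgue)" for k
  proof -
    define Q where "Q = T ` P k"
    have QY: "Q \<subseteq> Y" using PX TX by (auto simp: Q_def)
    have UQ: "U ` Q = P k" using PX UT by (force simp: Q_def)
    have inj: "inj_on U Q"
    proof (rule inj_on_inverseI[where g = T])
      fix y assume "y \<in> Q"
      then obtain x where "x \<in> P k" "y = T x" by (auto simp: Q_def)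
      then show "T (U y) = y" using UT[of x] subsetD[OF PX[of k]] by simp
    qed
    have Qm: "Q \<in> sets lebesgue"
      unfolding Q_def
    proof (rule differentiable_image_in_sets_lebesgue[OF Pm])
      show "T differentiable_on P k"
        unfolding differentiable_on_def
        using derT PX by (meson differentiable_def has_derivative_subset subsetD)
    qed simp
    have derQ: "(U has_derivative U' y) (at y within Q)" if "y \<in> Q" for y
      using derU QY that by (meson has_derivative_subset subsetD)
    have vP: "v absolutely_integrable_on (P k)"
    proof -
      have "v \<in> borel_measurable (lebesgue_on (P k))"
        using vm by (rule measurable_restrict_space1)
      then show ?thesis
        by (rule measurable_bounded_by_integrable_imp_absolutely_integrable[where g = "\<lambda>_. B"])
          (use B Plm in \<open>auto simp: integrable_on_const\<close>)
    qed
    \<comment> \<open>The classical theorem is stated for vector-valued integrands, hence the passage through \<open>real ^ 1\<close>.\<close>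
    have "(\<lambda>y. vec (v y) :: real^1) absolutely_integrable_on (U ` Q) \<and>
           integral (U ` Q) (\<lambda>y. vec (v y) :: real^1) = vec (integral (P k) v)"
      using vP by (simp add: UQ absolutely_integrable_on_1_iff integral_on_1_eq)
    then have "(\<lambda>y. \<bar>det (matrix (U' y))\<bar> *\<^sub>R (vec (v (U y)) :: real^1)) absolutely_integrable_on Q \<and>
           integral Q (\<lambda>y. \<bar>det (matrix (U' y))\<bar> *\<^sub>R (vec (v (U y)) :: real^1)) = vec (integral (P k) v)"
      using has_absolute_integral_change_of_variables[OF Qm derQ inj, of "\<lambda>y. vec (v y) :: real^1"]
      by blast
    then have cv: "(\<lambda>y. \<bar>det (matrix (U' y))\<bar> * v (U y)) absolutely_integrable_on Q"
       "integral Q (\<lambda>y. \<bar>det (matrix (U' y))\<bar> * v (U y)) = integral (P k) v"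
      by (simp_all add: absolutely_integrable_on_1_iff integral_on_1_eq)
    have "(\<integral>\<^sup>+x. u x * indicator (P k) x \<partial>lebesgue) = ennreal (integral (P k) v)"
      using nn_integral_absolutely_integrable[OF vP v0] by (simp add: uv)
    also have "\<dots> = (\<integral>\<^sup>+y. ennreal (\<bar>det (matrix (U' y))\<bar> * v (U y)) * indicator Q y \<partial>lebesgue)"
      using nn_integral_absolutely_integrable[OF cv(1)] v0 cv(2) by simp
    also have "\<dots> \<le> (\<integral>\<^sup>+y. G y * indicator Y y \<partial>lebesgue)"
    proof (rule nn_integral_mono)
      fix y
      show "ennreal (\<bar>det (matrix (U' y))\<bar> * v (U y)) * indicator Q y \<le> G y * indicator Y y"
      proof (cases "y \<in> Q")
        case True
        then obtain x where x: "x \<in> P k" "y = T x" by (auto simp: Q_def)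
        then have xX: "x \<in> X" using PX by auto
        have "ennreal (\<bar>det (matrix (U' y))\<bar> * v (U y)) = u x * ennreal \<bar>det (matrix (U' (T x)))\<bar>"
          using x UT[OF xX] by (simp add: uv ennreal_mult v0 mult.commute)
        also have "\<dots> \<le> F x * ennreal \<bar>det (matrix (U' (T x)))\<bar>"
          using uF[of x] xX by (intro mult_right_mono) auto
        also have "\<dots> \<le> G y" using le[OF xX] x by simp
        finally show ?thesis using True QY by auto
      qed simp
    qed
    finally show ?thesis .
  qed
  have "integral\<^sup>S lebesgue u = (\<integral>\<^sup>+x. u x \<partial>lebesgue)"
    using u by (rule nn_integral_eq_simple_integral[symmetric])
  also have "\<dots> = (\<integral>\<^sup>+x. (SUP k. u x * indicator (P k) x) \<partial>lebesgue)"
  proof (rule nn_integral_cong)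
    fix x
    show "u x = (SUP k. u x * indicator (P k) x)"
    proof (cases "u x = 0")
      case False
      obtain k :: nat where "norm x < real k" using reals_Archimedean2 by blast
      then have "x \<in> P k" using False by (simp add: P_def)
      then have "u x \<le> (SUP k. u x * indicator (P k) x)" by (intro SUP_upper2[of k]) auto
      moreover have "(SUP k. u x * indicator (P k) x) \<le> u x"
        by (intro SUP_least) (simp split: split_indicator)
      ultimately show ?thesis by (rule antisym)
    qed simp
  qed
  also have "\<dots> = (SUP k. \<integral>\<^sup>+x. u x * indicator (P k) x \<partial>lebesgue)"
  proof (rule nn_integral_monotone_convergence_SUP)
    show "incseq (\<lambda>k x. u x * indicator (P k) x)"
      by (auto simp: incseq_def le_fun_def P_def split: split_indicator)
  qed measurable
  also have "\<dots> \<le> (\<integral>\<^sup>+y. G y * indicator Y y \<partial>lebesgue)"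
    by (rule SUP_least) (rule bound)
  finally show "integral\<^sup>S lebesgue u \<le> (\<integral>\<^sup>+y. G y * indicator Y y \<partial>lebesgue)" .
qed

text \<open>
  The classical theorem needs a well-order on the index type of the coordinates. For an
  arbitrary finite index type this is supplied by a copy of it that is ordered as an
  initial segment of the natural numbers, and the result is carried back by a permutation
  of the coordinates.
\<close>

text \<open>
  A well-ordered type with as many elements as the finite type \<open>'n\<close>.
\<close>

typedef ('n::finite) ordered_index = "{..<CARD('n)}"
  using zero_less_card_finite by blast

instantiation ordered_index :: (finite) wellorder
begin

definition less_eq_ordered_index :: "'a ordered_index \<Rightarrow> 'a ordered_index \<Rightarrow> bool" where
  "i \<le> j \<longleftrightarrow> Rep_ordered_index i \<le> Rep_ordered_index j"

definition less_ordered_index :: "'a ordered_index \<Rightarrow> 'a ordered_index \<Rightarrow> bool" where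
  "i < j \<longleftrightarrow> Rep_ordered_index i < Rep_ordered_index j"

instance
proof
  fix P :: "'a ordered_index \<Rightarrow> bool" and a
  assume step: "\<And>x. (\<And>y. y < x \<Longrightarrow> P y) \<Longrightarrow> P x"
  show "P a"
  proof (induction "Rep_ordered_index a" arbitrary: a rule: less_induct)
    case less
    show ?case by (rule step, rule less) (simp add: less_ordered_index_def)
  qed
qed (auto simp: less_eq_ordered_index_def less_ordered_index_def Rep_ordered_index_inject)

end

instance ordered_index :: (finite) finite
proof
  show "finite (UNIV :: 'a ordered_index set)"
    unfolding type_definition.univ[OF type_definition_ordered_index] by simp
qed

lemma ex_bij_ordered_index: "\<exists>e :: 'n::finite ordered_index \<Rightarrow> 'n. bij e"
proof -
  have "CARD('n ordered_index) = CARD('n)"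
    using type_definition.card[OF type_definition_ordered_index] by simp
  then show ?thesis
    using finite_same_card_bij[of "UNIV :: 'n ordered_index set" "UNIV :: 'n set"] by simp
qed

lemma det_reindex:
  fixes A :: "'a::comm_ring_1 ^ 'n ^ 'n" and e :: "'m::finite \<Rightarrow> 'n"
  assumes e: "bij e"
  shows "det (\<chi> i j. A $ e i $ e j) = det A"
proof -
  let ?g = "map_permutation (UNIV :: 'm set) e"
  have inj: "inj e" and surj: "range e = UNIV" using e by (auto simp: bij_def)
  have app: "?g p (e i) = e (p i)" for p i
    by (rule map_permutation_apply) (use inj in auto)
  have bij: "bij_betw ?g {p. p permutes UNIV} {p. p permutes UNIV}"
  proof (rule bij_betwI[where g = "map_permutation UNIV (inv e)"])
    show "?g \<in> {p. p permutes UNIV} \<rightarrow> {p. p permutes UNIV}"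
      using e by (auto intro: map_permutation_permutes)
    show "map_permutation UNIV (inv e) \<in> {p. p permutes UNIV} \<rightarrow> {p. p permutes UNIV}"
      using bij_imp_bij_inv[OF e] by (auto intro: map_permutation_permutes)
    show "map_permutation UNIV (inv e) (?g p) = p" if "p \<in> {p. p permutes UNIV}" for p
      using that inj surj by (intro map_permutation_compose_inv) (auto simp: e)
    show "?g (map_permutation UNIV (inv e) p) = p" if "p \<in> {p. p permutes UNIV}" for p
      using that bij_imp_bij_inv[OF e] e 
      by (intro map_permutation_compose_inv) (auto simp: surj_f_inv_f bij_is_surj)
  qed
  have "det A = (\<Sum>p | p permutes (UNIV :: 'm set). of_int (sign (?g p)) * (\<Prod>i\<in>UNIV. A $ i $ ?g p i))"
    unfolding det_def by (rule sum.reindex_bij_betw[OF bij, symmetric])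
  also have "\<dots> = (\<Sum>p | p permutes (UNIV :: 'm set). of_int (sign p) * (\<Prod>i\<in>UNIV. A $ e i $ e (p i)))"
  proof (rule sum.cong[OF refl])
    fix p assume "p \<in> {p. p permutes (UNIV :: 'm set)}"
    then have "sign (?g p) = sign p" using inj by (intro sign_map_permutation) auto
    moreover have "(\<Prod>i\<in>UNIV. A $ i $ ?g p i) = (\<Prod>i\<in>UNIV. A $ e i $ ?g p (e i))"
      by (rule prod.reindex_bij_betw[OF e, symmetric])
    ultimately show "of_int (sign (?g p)) * (\<Prod>i\<in>UNIV. A $ i $ ?g p i)
        = of_int (sign p) * (\<Prod>i\<in>UNIV. A $ e i $ e (p i))"
      by (simp add: app)
  qed
  finally show ?thesis by (simp add: det_def)
qed

lemma lborel_reindex: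
  fixes e :: "'m::finite \<Rightarrow> 'n::finite"
  assumes e: "bij e"
  shows "distr lborel borel (\<lambda>x :: real ^ 'n. \<chi> i. x $ e i) = (lborel :: (real ^ 'm) measure)"
proof (rule lborel_eqI[symmetric])
  let ?r = "\<lambda>x :: real ^ 'n. (\<chi> i. x $ e i) :: real ^ 'm"
  have [measurable]: "?r \<in> borel_measurable borel"
    by (intro borel_measurable_continuous_onI continuous_intros)
  have basis: "(\<Prod>b\<in>Basis. (z :: real ^ 'k) \<bullet> b) = (\<Prod>i\<in>UNIV. z $ i)" for z :: "real ^ 'k::finite"
  proof -
    have "Basis = range (\<lambda>i. axis i (1::real) :: real ^ 'k)" by (auto simp: Basis_vec_def)
    moreover have "inj (\<lambda>i. axis i (1::real) :: real ^ 'k)" by (auto simp: inj_def axis_eq_axis)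
    ultimately have "(\<Prod>b\<in>Basis. z \<bullet> b) = (\<Prod>i\<in>UNIV. z \<bullet> axis i 1)"
      using prod.reindex[of "\<lambda>i. axis i (1::real) :: real ^ 'k" UNIV "\<lambda>b. z \<bullet> b"] by (simp add: o_def)
    then show ?thesis by (simp add: inner_axis)
  qed
  fix l u :: "real ^ 'm"
  assume lu: "\<And>b. b \<in> Basis \<Longrightarrow> l \<bullet> b \<le> u \<bullet> b"
  let ?s = "\<lambda>z :: real ^ 'm. (\<chi> i. z $ inv e i) :: real ^ 'n"
  have lu': "l $ i \<le> u $ i" for i
    using lu[of "axis i 1"] by (simp add: inner_axis)
  have pre: "?r -` box l u = box (?s l) (?s u)"
  proof -
    have ie: "inv e (e i) = i" for i using e by (simp add: bij_is_inj)
    have ei: "e (inv e j) = j" for j using e by (simp add: bij_is_surj surj_f_inv_f)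
    show ?thesis
      by (auto simp: mem_box_cart) (metis ei ie)+
  qed
  have "emeasure (distr lborel borel ?r) (box l u) = emeasure lborel (box (?s l) (?s u))"
    by (simp add: emeasure_distr pre)
  also have "\<dots> = (\<Prod>b\<in>Basis. (?s u - ?s l) \<bullet> b)"
    using lu' by (intro emeasure_lborel_box) (auto simp: Basis_vec_def inner_axis)
  also have "(\<Prod>b\<in>Basis. (?s u - ?s l) \<bullet> b) = (\<Prod>i\<in>UNIV. (u - l) $ inv e i)"
    unfolding basis by simp
  also have "\<dots> = (\<Prod>i\<in>UNIV. (u - l) $ i)"
    by (rule prod.reindex_bij_betw[OF bij_imp_bij_inv[OF e]])
  also have "\<dots> = (\<Prod>b\<in>Basis. (u - l) \<bullet> b)" by (simp only: basis)
  finally show "emeasure (distr lborel borel ?r) (box l u) = ennreal (\<Prod>b\<in>Basis. (u - l) \<bullet> b)" .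
qed simp

text \<open>
  Measure-preserving isomorphisms respect the integral also of functions that are not
  measurable.
\<close>

lemma nn_integral_le_distr_inverse:
  assumes r: "r \<in> M \<rightarrow>\<^sub>M N" and q: "q \<in> N \<rightarrow>\<^sub>M M" and d: "distr M N r = N"
    and inv: "\<And>x. x \<in> space M \<Longrightarrow> q (r x) = x"
  shows "(\<integral>\<^sup>+x. F x \<partial>M) \<le> (\<integral>\<^sup>+y. F (q y) \<partial>N)"
  unfolding nn_integral_def[of M F]
proof (rule SUP_least)
  fix u assume "u \<in> {g. simple_function M g \<and> g \<le> F}"
  then have u: "simple_function M u" "u \<le> F" by auto
  have um [measurable]: "u \<in> borel_measurable M" using u by (blast intro: borel_measurable_simple_function)
  note [measurable] = r q
  have "integral\<^sup>S M u = (\<integral>\<^sup>+x. u x \<partial>M)" using u by (simp add: nn_integral_eq_simple_integral)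
  also have "\<dots> = (\<integral>\<^sup>+x. u (q (r x)) \<partial>M)" by (rule nn_integral_cong) (simp add: inv)
  also have "\<dots> = (\<integral>\<^sup>+y. u (q y) \<partial>distr M N r)" by (simp add: nn_integral_distr)
  also have "\<dots> \<le> (\<integral>\<^sup>+y. F (q y) \<partial>N)" unfolding d using u by (intro nn_integral_mono) (auto simp: le_fun_def)
  finally show "integral\<^sup>S M u \<le> (\<integral>\<^sup>+y. F (q y) \<partial>N)" .
qed

lemma nn_integral_reindex:
  fixes e :: "'m::finite \<Rightarrow> 'n::finite" and F :: "real ^ 'n \<Rightarrow> ennreal"
  assumes e: "bij e"
  shows "(\<integral>\<^sup>+x. F x \<partial>lebesgue) = (\<integral>\<^sup>+y. F (\<chi> i. y $ inv e i) \<partial>(lebesgue :: (real ^ 'm) measure))"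
proof -
  let ?r = "\<lambda>x :: real ^ 'n. (\<chi> i. x $ e i) :: real ^ 'm"
  let ?s = "\<lambda>z :: real ^ 'm. (\<chi> i. z $ inv e i) :: real ^ 'n"
  have ie: "inv e (e i) = i" for i using e by (simp add: bij_is_inj)
  have ei: "e (inv e j) = j" for j using e by (simp add: bij_is_surj surj_f_inv_f)
  have m: "?r \<in> lborel \<rightarrow>\<^sub>M lborel" "?s \<in> lborel \<rightarrow>\<^sub>M lborel"
    by (simp_all, (intro borel_measurable_continuous_onI continuous_intros)+)
  have d: "distr lborel lborel ?r = lborel" "distr lborel lborel ?s = lborel"
    using lborel_reindex[OF e] lborel_reindex[OF bij_imp_bij_inv[OF e]]
    by (simp_all cong: distr_cong)
  have "(\<integral>\<^sup>+x. F x \<partial>lborel) \<le> (\<integral>\<^sup>+y. F (?s y) \<partial>lborel)"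
    by (rule nn_integral_le_distr_inverse[OF m d(1)]) (simp add: ei)
  moreover have "(\<integral>\<^sup>+y. F (?s y) \<partial>lborel) \<le> (\<integral>\<^sup>+x. F (?s (?r x)) \<partial>lborel)"
    by (rule nn_integral_le_distr_inverse[OF m(2,1) d(2)]) (simp add: ie)
  moreover have "?s (?r x) = x" for x by (simp add: ei)
  ultimately show ?thesis unfolding nn_integral_completion by simp
qed

lemma nn_integral_le_change_of_variables:
  fixes T U :: "real ^ 'n \<Rightarrow> real ^ 'n" and F G :: "real ^ 'n \<Rightarrow> ennreal"
  assumes derT: "\<And>x. x \<in> X \<Longrightarrow> (T has_derivative T' x) (at x within X)"
    and derU: "\<And>y. y \<in> Y \<Longrightarrow> (U has_derivative U' y) (at y within Y)"
    and TX: "\<And>x. x \<in> X \<Longrightarrow> T x \<in> Y" and UT: "\<And>x. x \<in> X \<Longrightarrow> U (T x) = x"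
    and le: "\<And>x. x \<in> X \<Longrightarrow> F x * ennreal \<bar>det (matrix (U' (T x)))\<bar> \<le> G (T x)"
  shows "(\<integral>\<^sup>+x. F x * indicator X x \<partial>lebesgue) \<le> (\<integral>\<^sup>+y. G y * indicator Y y \<partial>lebesgue)"
proof -
  obtain e :: "'n ordered_index \<Rightarrow> 'n" where e: "bij e" using ex_bij_ordered_index by blast
  define r where "r = (\<lambda>x :: real ^ 'n. (\<chi> i. x $ e i) :: real ^ 'n ordered_index)"
  define q where "q = (\<lambda>z :: real ^ 'n ordered_index. (\<chi> i. z $ inv e i) :: real ^ 'n)"
  have ie: "inv e (e i) = i" for i using e by (simp add: bij_is_inj)
  have ei: "e (inv e j) = j" for j using e by (simp add: bij_is_surj surj_f_inv_f)
  have q_apply: "(\<chi> i. z $ inv e i) = q z" for z by (simp add: q_def)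
  have qr: "q (r x) = x" for x by (simp add: q_def r_def ei)
  have rq: "r (q z) = z" for z by (simp add: q_def r_def ie)
  have linr: "linear r" and linq: "linear q"
    by (auto intro!: linearI simp: r_def q_def vec_eq_iff)
  then have derr: "(r has_derivative r) F" and derq: "(q has_derivative q) F'" for F F'
    by (simp_all add: linear_conv_bounded_linear bounded_linear_imp_has_derivative)
  \<comment> \<open>Conjugation by the coordinate permutation \<open>r\<close>, with inverse \<open>q\<close>, preserves derivatives and determinants.\<close>
  have conj_der: "((\<lambda>z. r (V (q z))) has_derivative (\<lambda>z. r (D (q z)))) (at a within r ` W)"
    if V: "(V has_derivative D) (at (q a) within W)" for V D a W
  proof -
    have "q ` r ` W = W" by (simp add: image_image qr)
    then have "((\<lambda>z. V (q z)) has_derivative (\<lambda>z. D (q z))) (at a within r ` W)"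
      using has_derivative_in_compose[OF derq, of V D a "r ` W"] V by simp
    then show ?thesis by (rule has_derivative_compose) (rule derr)
  qed
  have det_conj: "det (matrix (\<lambda>z. r (D (q z)))) = det (matrix D)" if "linear D" for D
  proof -
    have "q (axis j 1) = axis (e j) 1" for j
      by (auto simp: q_def axis_def vec_eq_iff ie ei)
    then have "matrix (\<lambda>z. r (D (q z))) = (\<chi> i j. matrix D $ e i $ e j)"
      by (simp add: matrix_def r_def)
    then show ?thesis by (simp add: det_reindex[OF e])
  qed
  have ind: "indicator W (q z) = (indicator (r ` W) z :: ennreal)" for W z
    by (auto split: split_indicator simp: rq) (metis qr imageI rq)+
  have "(\<integral>\<^sup>+x. F x * indicator X x \<partial>lebesgue)
      = (\<integral>\<^sup>+z. F (q z) * indicator (r ` X) z \<partial>lebesgue)"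
    by (subst nn_integral_reindex[OF e]) (simp add: q_apply ind)
  also have "\<dots> \<le> (\<integral>\<^sup>+z. G (q z) * indicator (r ` Y) z \<partial>lebesgue)"
  proof (rule nn_integral_le_change_of_variables_wellorder[where T = "\<lambda>z. r (T (q z))" and U = "\<lambda>z. r (U (q z))"])
    show "((\<lambda>z. r (T (q z))) has_derivative (\<lambda>w. r (T' (q z) (q w)))) (at z within r ` X)"
      if "z \<in> r ` X" for z
      using that by (intro conj_der derT) (auto simp: qr)
    show "((\<lambda>z. r (U (q z))) has_derivative (\<lambda>w. r (U' (q z) (q w)))) (at z within r ` Y)"
      if "z \<in> r ` Y" for z
      using that by (intro conj_der derU) (auto simp: qr)
    show "r (T (q z)) \<in> r ` Y" if "z \<in> r ` X" for z using that TX by (auto simp: qr)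
    show "r (U (q (r (T (q z))))) = z" if "z \<in> r ` X" for z using that UT by (auto simp: qr)
    show "F (q z) * ennreal \<bar>det (matrix (\<lambda>w. r (U' (q (r (T (q z)))) (q w))))\<bar> \<le> G (q (r (T (q z))))"
      if "z \<in> r ` X" for z
    proof -
      from that obtain x where x: "x \<in> X" "z = r x" by auto
      have "linear (U' (T x))" using derU[OF TX[OF x(1)]] by (rule has_derivative_linear)
      then show ?thesis using le[OF x(1)] by (simp add: x qr det_conj)
    qed
  qed
  also have "\<dots> = (\<integral>\<^sup>+y. G y * indicator Y y \<partial>lebesgue)"
    by (subst nn_integral_reindex[OF e, of "\<lambda>y. G y * indicator Y y"]) (simp add: q_apply ind)
  finally show ?thesis .
qed

text \<open>
  Change of variables along a bijection \<open>T\<close> with inverse \<open>U\<close> between arbitrary sets. Both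
  maps are differentiable relative to their domains. Such derivatives need not be unique,
  so it is a hypothesis that the chosen Jacobian determinants are reciprocal.
\<close>

lemma nn_integral_change_of_variables:
  fixes T U :: "real ^ 'n \<Rightarrow> real ^ 'n" and F G :: "real ^ 'n \<Rightarrow> ennreal"
  assumes derT: "\<And>x. x \<in> X \<Longrightarrow> (T has_derivative T' x) (at x within X)"
    and derU: "\<And>y. y \<in> Y \<Longrightarrow> (U has_derivative U' y) (at y within Y)"
    and TX: "\<And>x. x \<in> X \<Longrightarrow> T x \<in> Y" and UT: "\<And>x. x \<in> X \<Longrightarrow> U (T x) = x"
    and UY: "\<And>y. y \<in> Y \<Longrightarrow> U y \<in> X" and TU: "\<And>y. y \<in> Y \<Longrightarrow> T (U y) = y"
    and inverse_dets: "\<And>x. x \<in> X \<Longrightarrow> det (matrix (T' x)) * det (matrix (U' (T x))) = 1"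
    and eq: "\<And>x. x \<in> X \<Longrightarrow> F x = G (T x) * ennreal \<bar>det (matrix (T' x))\<bar>"
  shows "(\<integral>\<^sup>+x. F x * indicator X x \<partial>lebesgue) = (\<integral>\<^sup>+y. G y * indicator Y y \<partial>lebesgue)"
proof (rule antisym)
  show "(\<integral>\<^sup>+x. F x * indicator X x \<partial>lebesgue) \<le> (\<integral>\<^sup>+y. G y * indicator Y y \<partial>lebesgue)"
  proof (rule nn_integral_le_change_of_variables[OF derT derU TX UT])
    fix x assume x: "x \<in> X"
    have "ennreal \<bar>det (matrix (T' x))\<bar> * ennreal \<bar>det (matrix (U' (T x)))\<bar> = 1"
      using inverse_dets[OF x] by (simp flip: ennreal_mult abs_mult)
    then show "F x * ennreal \<bar>det (matrix (U' (T x)))\<bar> \<le> G (T x)"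
      by (simp add: eq[OF x] mult.assoc)
  qed
  show "(\<integral>\<^sup>+y. G y * indicator Y y \<partial>lebesgue) \<le> (\<integral>\<^sup>+x. F x * indicator X x \<partial>lebesgue)"
  proof (rule nn_integral_le_change_of_variables[OF derU derT UY TU])
    fix y assume y: "y \<in> Y"
    show "G y * ennreal \<bar>det (matrix (T' (U y)))\<bar> \<le> F (U y)"
      using eq[OF UY[OF y]] TU[OF y] by simp
  qed
qed

section \<open>Second-order expansions\<close>

text \<open>
  The second-order Taylor expansion of \<open>\<phi>\<close> at \<open>x\<close> with gradient \<open>v\<close> and matrix \<open>M\<close>, in
  \<open>\<epsilon>\<close>-\<open>\<delta>\<close> form. The matrix is not required to be symmetric here.
\<close>

definition expands_at :: "(real ^ 'n \<Rightarrow> real) \<Rightarrow> real ^ 'n \<Rightarrow> real ^ 'n \<Rightarrow> real ^ 'n ^ 'n \<Rightarrow> bool" where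
  "expands_at \<phi> x v M \<longleftrightarrow>
     (\<forall>\<epsilon>>0. \<exists>\<delta>>0. \<forall>h. norm h < \<delta> \<longrightarrow>
        \<bar>\<phi> (x + h) - \<phi> x - v \<bullet> h - (h \<bullet> (M *v h)) / 2\<bar> \<le> \<epsilon> * (norm h)\<^sup>2)"

lemma expands_at_cong:
  assumes "expands_at \<phi> x v M" and "open U" and "x \<in> U" and "\<And>z. z \<in> U \<Longrightarrow> \<phi> z = \<theta> z"
  shows "expands_at \<theta> x v M"
  unfolding expands_at_def
proof (intro allI impI)
  fix \<epsilon> :: real assume "\<epsilon> > 0"
  then obtain \<delta> where \<delta>: "\<delta> > 0"
    "\<And>h. norm h < \<delta> \<Longrightarrow> \<bar>\<phi> (x + h) - \<phi> x - v \<bullet> h - (h \<bullet> (M *v h)) / 2\<bar> \<le> \<epsilon> * (norm h)\<^sup>2"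
    using assms(1) unfolding expands_at_def by meson
  obtain r where r: "r > 0" "ball x r \<subseteq> U" using assms(2,3) openE by blast
  have "\<phi> (x + h) = \<theta> (x + h)" if "norm h < r" for h
    using r that by (intro assms(4)) (auto simp: dist_norm)
  moreover have "\<phi> x = \<theta> x" by (rule assms(4)[OF assms(3)])
  ultimately have "\<forall>h. norm h < min \<delta> r \<longrightarrow>
        \<bar>\<theta> (x + h) - \<theta> x - v \<bullet> h - (h \<bullet> (M *v h)) / 2\<bar> \<le> \<epsilon> * (norm h)\<^sup>2"
    using \<delta>(2) by (metis min_less_iff_conj)
  then show "\<exists>\<delta>>0. \<forall>h. norm h < \<delta> \<longrightarrow>
        \<bar>\<theta> (x + h) - \<theta> x - v \<bullet> h - (h \<bullet> (M *v h)) / 2\<bar> \<le> \<epsilon> * (norm h)\<^sup>2"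
    using \<delta>(1) r(1) by (intro exI[of _ "min \<delta> r"]) auto
qed

lemma expands_at_iff_tendsto:
  "expands_at \<phi> x v M \<longleftrightarrow>
     ((\<lambda>h. (\<phi> (x + h) - \<phi> x - v \<bullet> h - (h \<bullet> (M *v h)) / 2) / (norm h)\<^sup>2) \<longlongrightarrow> 0) (at 0)"
    (is "_ \<longleftrightarrow> (?q \<longlongrightarrow> 0) (at 0)")
proof
  let ?r = "\<lambda>h. \<phi> (x + h) - \<phi> x - v \<bullet> h - (h \<bullet> (M *v h)) / 2"
  assume e: "expands_at \<phi> x v M"
  show "(?q \<longlongrightarrow> 0) (at 0)"
    unfolding LIM_def
  proof (intro allI impI)
    fix e :: real assume "e > 0"
    then have "e / 2 > 0" by simp
    then obtain \<delta> where \<delta>: "\<delta> > 0" "\<And>h. norm h < \<delta> \<Longrightarrow> \<bar>?r h\<bar> \<le> (e / 2) * (norm h)\<^sup>2"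
      using e unfolding expands_at_def by meson
    have "\<bar>?q h\<bar> < e" if "h \<noteq> 0" "norm h < \<delta>" for h
    proof -
      have "(norm h)\<^sup>2 > 0" using that(1) by simp
      then have "\<bar>?r h\<bar> / (norm h)\<^sup>2 \<le> e / 2"
        using \<delta>(2)[OF that(2)] by (simp only: pos_divide_le_eq)
      then show ?thesis using \<open>e > 0\<close> by (simp only: abs_divide abs_power2 abs_norm_cancel)
    qed
    then show "\<exists>s>0. \<forall>h. h \<noteq> 0 \<and> dist h 0 < s \<longrightarrow> dist (?q h) 0 < e"
      using \<delta>(1) by (auto intro!: exI[of _ \<delta>])
  qed
next
  let ?r = "\<lambda>h. \<phi> (x + h) - \<phi> x - v \<bullet> h - (h \<bullet> (M *v h)) / 2"
  assume l: "(?q \<longlongrightarrow> 0) (at 0)"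
  show "expands_at \<phi> x v M"
    unfolding expands_at_def
  proof (intro allI impI)
    fix e :: real assume "e > 0"
    then obtain s where s: "s > 0" "\<And>h. h \<noteq> 0 \<Longrightarrow> norm h < s \<Longrightarrow> \<bar>?q h\<bar> < e"
      using l unfolding LIM_def by (auto simp: dist_norm)
    have "\<bar>?r h\<bar> \<le> e * (norm h)\<^sup>2" if "norm h < s" for h
    proof (cases "h = 0")
      case False
      then show ?thesis using s(2)[OF False that] by (simp add: abs_divide divide_less_eq)
    qed simp
    then show "\<exists>\<delta>>0. \<forall>h. norm h < \<delta> \<longrightarrow> \<bar>?r h\<bar> \<le> e * (norm h)\<^sup>2"
      using s(1) by blast
  qed
qed

lemma quadratic_form_le: "\<bar>h \<bullet> (M *v h)\<bar> \<le> onorm ((*v) M) * (norm h)\<^sup>2" for M :: "real ^ 'n ^ 'n"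
proof -
  have "\<bar>h \<bullet> (M *v h)\<bar> \<le> norm h * norm (M *v h)" by (rule Cauchy_Schwarz_ineq2)
  also have "\<dots> \<le> norm h * (onorm ((*v) M) * norm h)"
    by (intro mult_left_mono onorm) auto
  finally show ?thesis by (simp add: power2_eq_square mult_ac)
qed

lemma expands_at_imp_GDERIV:
  assumes "expands_at \<phi> x v M"
  shows "GDERIV \<phi> x :> v"
  unfolding gderiv_def has_derivative_at_alt
proof (intro conjI allI impI)
  show "bounded_linear (\<lambda>h. h \<bullet> v)" by (rule bounded_linear_inner_left)
  fix e :: real assume e: "e > 0"
  define C where "C = onorm ((*v) M)"
  have C: "C \<ge> 0" unfolding C_def by (rule onorm_pos_le) simp
  obtain \<delta> where \<delta>: "\<delta> > 0"
    "\<And>h. norm h < \<delta> \<Longrightarrow> \<bar>\<phi> (x + h) - \<phi> x - v \<bullet> h - (h \<bullet> (M *v h)) / 2\<bar> \<le> 1 * (norm h)\<^sup>2"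
    using assms unfolding expands_at_def by (meson zero_less_one)
  define d where "d = min \<delta> (e / (1 + C))"
  have "d > 0" using \<delta> e C by (simp add: d_def)
  moreover have "norm (\<phi> y - \<phi> x - (y - x) \<bullet> v) \<le> e * norm (y - x)" if "norm (y - x) < d" for y
  proof -
    define h where "h = y - x"
    have y: "y = x + h" by (simp add: h_def)
    have hd: "norm h < \<delta>" "norm h < e / (1 + C)" using that by (auto simp: h_def d_def)
    have "\<bar>\<phi> (x + h) - \<phi> x - v \<bullet> h\<bar> \<le> (norm h)\<^sup>2 + C * (norm h)\<^sup>2"
      using \<delta>(2)[OF hd(1)] quadratic_form_le[of h M] C
      by (auto simp: C_def[symmetric] abs_le_iff) 
    also have "\<dots> = ((1 + C) * norm h) * norm h" by (simp add: power2_eq_square algebra_simps)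
    also have "\<dots> \<le> e * norm h"
      using hd(2) C by (intro mult_right_mono) (auto simp: field_simps)
    finally show ?thesis by (simp add: y inner_commute)
  qed
  ultimately show "\<exists>d>0. \<forall>y. norm (y - x) < d \<longrightarrow> norm (\<phi> y - \<phi> x - (y - x) \<bullet> v) \<le> e * norm (y - x)"
    by blast
qed

lemma GDERIV_unique:
  assumes "GDERIV \<phi> x :> p" "GDERIV \<phi> x :> q"
  shows "p = q"
proof -
  have "(\<lambda>h. h \<bullet> p) = (\<lambda>h. h \<bullet> q)"
    using assms unfolding gderiv_def by (rule has_derivative_unique)
  then have "h \<bullet> p = h \<bullet> q" for h by (rule fun_cong)
  then show ?thesis using vector_eq_ldot[of p q] by blast
qed

lemma gradient_eqI: "GDERIV \<phi> x :> p \<Longrightarrow> gradient \<phi> x = p"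
  unfolding gradient_def by (blast intro: GDERIV_unique)

lemma has_alexandrov_hessian_iff:
  "has_alexandrov_hessian \<phi> M x \<longleftrightarrow> transpose M = M \<and> (\<exists>v. expands_at \<phi> x v M)"
  unfolding has_alexandrov_hessian_def
  using expands_at_iff_tendsto expands_at_imp_GDERIV by blast

lemma symmetric_matrix_inner:
  fixes M :: "real ^ 'n ^ 'n"
  assumes "transpose M = M"
  shows "(M *v a) \<bullet> b = a \<bullet> (M *v b)"
  by (metis assms dot_lmul_matrix inner_commute transpose_matrix_vector)

lemma symmetric_matrix_eqI:
  fixes A B :: "real ^ 'n ^ 'n"
  assumes "transpose A = A" "transpose B = B" and eq: "\<And>h. h \<bullet> (A *v h) = h \<bullet> (B *v h)"
  shows "A = B"
proof -
  have "a \<bullet> (A *v b) = a \<bullet> (B *v b)" for a b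
    using eq[of "a + b"] eq[of a] eq[of b] symmetric_matrix_inner[OF assms(1), of b a]
      symmetric_matrix_inner[OF assms(2), of b a]
    by (simp add: matrix_vector_right_distrib inner_add_left inner_add_right inner_commute)
  then have "A *v b = B *v b" for b using vector_eq_ldot[of "A *v b" "B *v b"] by blast
  then show ?thesis by (simp add: matrix_eq)
qed

lemma expands_at_unique:
  fixes A B :: "real ^ 'n ^ 'n"
  assumes "transpose A = A" "transpose B = B" "expands_at \<phi> x v A" "expands_at \<phi> x w B"
  shows "A = B" "v = w"
proof -
  show vw: "v = w" using assms expands_at_imp_GDERIV GDERIV_unique by metis
  have "h \<bullet> (A *v h) = h \<bullet> (B *v h)" for h
  proof (rule ccontr)
    assume ne: "h \<bullet> (A *v h) \<noteq> h \<bullet> (B *v h)"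
    then have h0: "h \<noteq> 0" by auto
    define c where "c = \<bar>h \<bullet> (A *v h) - h \<bullet> (B *v h)\<bar>"
    have c: "c > 0" using ne by (simp add: c_def)
    define \<epsilon> where "\<epsilon> = c / (8 * (norm h)\<^sup>2)"
    have e: "\<epsilon> > 0" using c h0 by (simp add: \<epsilon>_def)
    obtain \<delta>1 where \<delta>1: "\<delta>1 > 0"
      "\<And>h. norm h < \<delta>1 \<Longrightarrow> \<bar>\<phi> (x + h) - \<phi> x - v \<bullet> h - (h \<bullet> (A *v h)) / 2\<bar> \<le> \<epsilon> * (norm h)\<^sup>2"
      using assms(3) e unfolding expands_at_def by meson
    obtain \<delta>2 where \<delta>2: "\<delta>2 > 0"
      "\<And>h. norm h < \<delta>2 \<Longrightarrow> \<bar>\<phi> (x + h) - \<phi> x - w \<bullet> h - (h \<bullet> (B *v h)) / 2\<bar> \<le> \<epsilon> * (norm h)\<^sup>2"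
      using assms(4) e unfolding expands_at_def by meson
    define t where "t = min \<delta>1 \<delta>2 / (2 * norm h)"
    have t: "t > 0" using \<delta>1 \<delta>2 h0 by (simp add: t_def)
    have nt: "norm (t *\<^sub>R h) < \<delta>1" "norm (t *\<^sub>R h) < \<delta>2"
      using \<delta>1(1) \<delta>2(1) h0 by (auto simp: t_def)
    have q: "(t *\<^sub>R h) \<bullet> (M *v (t *\<^sub>R h)) = t\<^sup>2 * (h \<bullet> (M *v h))" for M :: "real ^ 'n ^ 'n"
      by (simp add: matrix_vector_mult_scaleR power2_eq_square)
    have "\<bar>t\<^sup>2 * (h \<bullet> (A *v h)) - t\<^sup>2 * (h \<bullet> (B *v h))\<bar> \<le> 4 * (\<epsilon> * (norm (t *\<^sub>R h))\<^sup>2)"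
      using \<delta>1(2)[OF nt(1)] \<delta>2(2)[OF nt(2)] unfolding q vw by linarith
    also have "\<dots> = t\<^sup>2 * (c / 2)" using h0 by (simp add: \<epsilon>_def power_mult_distrib)
    finally have "\<bar>t\<^sup>2 * (h \<bullet> (A *v h)) - t\<^sup>2 * (h \<bullet> (B *v h))\<bar> \<le> t\<^sup>2 * (c / 2)" .
    moreover have "\<bar>t\<^sup>2 * (h \<bullet> (A *v h)) - t\<^sup>2 * (h \<bullet> (B *v h))\<bar> = t\<^sup>2 * c"
      by (simp only: c_def abs_mult abs_power2 right_diff_distrib[symmetric])
    ultimately have "t\<^sup>2 * c \<le> t\<^sup>2 * (c / 2)" by simp
    then show False using t c by simp
  qed
  then show "A = B" by (rule symmetric_matrix_eqI[OF assms(1,2)])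
qed

lemma gradient_eq: "expands_at \<phi> x v M \<Longrightarrow> gradient \<phi> x = v"
  by (rule gradient_eqI) (rule expands_at_imp_GDERIV)

lemma hessian_eq:
  assumes "expands_at \<phi> x v M" "transpose M = M"
  shows "hessian \<phi> x = M"
  unfolding hessian_def has_alexandrov_hessian_iff
  by (rule the_equality) (use assms expands_at_unique in blast)+

section \<open>Determinants of rank-one updates\<close>

text \<open>
  The outer product, that is, the matrix of the map that sends \<open>z\<close> to \<open>(b \<bullet> z) a\<close>.
\<close>

definition outer :: "real ^ 'n \<Rightarrow> real ^ 'n \<Rightarrow> real ^ 'n ^ 'n" where
  "outer a b = (\<chi> i j. a $ i * b $ j)"

lemma outer_mult_vec: "outer a b *v z = (b \<bullet> z) *\<^sub>R a"
  by (simp add: outer_def matrix_vector_mult_def inner_vec_def vec_eq_iff sum_distrib_left sum_distrib_right mult_ac)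

text \<open>
  An orthogonal change of coordinates turns \<open>b\<close> into a multiple of a coordinate vector;
  then the matrix differs from the identity in a single column, and Cramer's rule gives
  its determinant.
\<close>

lemma det_rank_one_update:
  fixes a b :: "real ^ 'n"
  shows "det (mat 1 + outer a b) = 1 + a \<bullet> b"
proof (cases "b = 0")
  case True
  then have "outer a b = 0" by (simp add: outer_def vec_eq_iff)
  then show ?thesis using True by simp
next
  case False
  fix k :: 'n
  obtain Q where Q: "orthogonal_matrix Q" "Q *v (axis k 1) = (1 / norm b) *\<^sub>R b"
    using orthogonal_matrix_exists_basis[of "(1 / norm b) *\<^sub>R b" k] False by auto
  have QQ: "transpose Q ** Q = mat 1" "Q ** transpose Q = mat 1"
    using Q(1) by (auto simp: orthogonal_matrix_def)
  define a' where "a' = norm b *\<^sub>R (transpose Q *v a)"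
  have Qa: "Q *v a' = norm b *\<^sub>R a"
    by (simp only: a'_def matrix_vector_mult_scaleR matrix_vector_mul_assoc QQ matrix_vector_mul_lid)
  define B where "B = (mat 1 + outer a' (axis k 1))"
  have bQ: "b \<bullet> (Q *v z) = norm b * (axis k 1 \<bullet> z)" for z
  proof -
    have "b = norm b *\<^sub>R (Q *v axis k 1)" using Q(2) False by simp
    then have "b \<bullet> (Q *v z) = norm b * ((Q *v axis k 1) \<bullet> (Q *v z))" by (metis inner_scaleR_left)
    also have "(Q *v axis k 1) \<bullet> (Q *v z) = axis k 1 \<bullet> z"
      by (metis QQ(1) dot_lmul_matrix matrix_vector_mul_assoc matrix_vector_mul_lid 
          transpose_matrix_vector transpose_transpose)
    finally show ?thesis .
  qed
  have "(mat 1 + outer a b) ** Q = Q ** B"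
    unfolding matrix_eq
  proof
    fix z
    show "((mat 1 + outer a b) ** Q) *v z = (Q ** B) *v z"
      by (simp add: B_def matrix_vector_mult_add_rdistrib outer_mult_vec bQ Qa matrix_vector_right_distrib
          matrix_vector_mult_scaleR mult.commute flip: matrix_vector_mul_assoc)
  qed
  then have "det (mat 1 + outer a b) * det Q = det Q * det B" by (metis det_mul)
  moreover have "det Q \<noteq> 0" using det_orthogonal_matrix[OF Q(1)] by auto
  ultimately have "det (mat 1 + outer a b) = det B" by simp
  also have "B = (\<chi> i j. if j = k then (mat 1 *v (axis k 1 + a')) $ i else mat 1 $ i $ j)"
    unfolding matrix_vector_mul_lid by (auto simp: B_def outer_def vec_eq_iff axis_def mat_def)
  also have "det \<dots> = (axis k 1 + a') $ k * det (mat 1 :: real ^ 'n ^ 'n)" by (rule cramer_lemma)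
  also have "\<dots> = 1 + a' $ k" by simp
  also have "a' $ k = a \<bullet> b"
  proof -
    have "a' $ k = norm b * ((transpose Q *v a) \<bullet> axis k 1)" by (simp add: a'_def inner_axis)
    also have "(transpose Q *v a) \<bullet> axis k 1 = a \<bullet> (Q *v axis k 1)"
      by (metis dot_lmul_matrix transpose_matrix_vector)
    finally show ?thesis using Q(2) False by simp
  qed
  finally show ?thesis .
qed

lemma det_scaleR: "det (c *\<^sub>R A) = c ^ CARD('n) * det A" for A :: "real ^ 'n ^ 'n"
proof -
  have "c *\<^sub>R A = (c *\<^sub>R mat 1) ** A"
    using scalar_matrix_assoc[of c "mat 1" A] by simp
  moreover have "det (c *\<^sub>R mat 1 :: real ^ 'n ^ 'n) = c ^ CARD('n)"
    by (subst det_diagonal) (auto simp: mat_def)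
  ultimately show ?thesis by (simp add: det_mul)
qed

section \<open>Convex functions with a second-order expansion\<close>

lemma le_of_small_linear_le:
  fixes a b K \<tau> :: real
  assumes "\<tau> > 0" and le: "\<And>t. 0 < t \<Longrightarrow> t < \<tau> \<Longrightarrow> a + t * K \<le> b"
  shows "a \<le> b"
proof (rule field_le_epsilon)
  fix e :: real assume e: "e > 0"
  define t where "t = min (\<tau> / 2) (e / (\<bar>K\<bar> + 1))"
  have t: "0 < t" "t < \<tau>" "t \<le> e / (\<bar>K\<bar> + 1)" using assms(1) e by (auto simp: t_def)
  have "t * (\<bar>K\<bar> + 1) \<le> e" using t(3) by (simp add: pos_le_divide_eq)
  moreover have "- (t * K) \<le> t * (\<bar>K\<bar> + 1)"
  proof -
    have "t * (- K) \<le> t * (\<bar>K\<bar> + 1)" using t(1) by (intro mult_left_mono) auto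
    then show ?thesis by simp
  qed
  ultimately show "a \<le> b + e" using le[OF t(1,2)] by linarith
qed

lemma expands_at_along_ray:
  assumes "expands_at \<phi> x v M" and e: "e > 0"
  obtains \<tau> where "\<tau> > 0"
    "\<And>t. 0 < t \<Longrightarrow> t < \<tau> \<Longrightarrow>
       \<bar>\<phi> (x + t *\<^sub>R h) - \<phi> x - t * (v \<bullet> h) - t\<^sup>2 * (h \<bullet> (M *v h)) / 2\<bar> \<le> e * t\<^sup>2"
proof -
  have "e / (1 + (norm h)\<^sup>2) > 0" using e by (simp add: add_pos_nonneg)
  then obtain \<delta> where \<delta>: "\<delta> > 0" "\<And>z. norm z < \<delta> \<Longrightarrow>
      \<bar>\<phi> (x + z) - \<phi> x - v \<bullet> z - (z \<bullet> (M *v z)) / 2\<bar> \<le> e / (1 + (norm h)\<^sup>2) * (norm z)\<^sup>2"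
    using assms(1) unfolding expands_at_def by meson
  show thesis
  proof (rule that[of "\<delta> / (1 + norm h)"])
    show "\<delta> / (1 + norm h) > 0" using \<delta>(1) by (simp add: add_pos_nonneg)
    fix t assume t: "0 < t" "t < \<delta> / (1 + norm h)"
    have "t * norm h \<le> t * (1 + norm h)" using t by simp
    also have "\<dots> < \<delta>" using t by (simp add: pos_less_divide_eq add_pos_nonneg)
    finally have "norm (t *\<^sub>R h) < \<delta>" using t by simp
    from \<delta>(2)[OF this]
    have "\<bar>\<phi> (x + t *\<^sub>R h) - \<phi> x - t * (v \<bullet> h) - t\<^sup>2 * (h \<bullet> (M *v h)) / 2\<bar>
        \<le> e / (1 + (norm h)\<^sup>2) * (norm (t *\<^sub>R h))\<^sup>2"
      by (simp add: matrix_vector_mult_scaleR power2_eq_square mult.assoc)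
    also have "\<dots> = e * t\<^sup>2 * ((norm h)\<^sup>2 / (1 + (norm h)\<^sup>2))"
      by (simp add: power_mult_distrib mult_ac)
    also have "\<dots> \<le> e * t\<^sup>2 * 1"
      using e by (intro mult_left_mono) (auto simp: divide_le_eq_1 add_pos_nonneg)
    finally show "\<bar>\<phi> (x + t *\<^sub>R h) - \<phi> x - t * (v \<bullet> h) - t\<^sup>2 * (h \<bullet> (M *v h)) / 2\<bar> \<le> e * t\<^sup>2"
      by simp
  qed
qed

lemma convex_on_ge_tangent:
  assumes cvx: "convex_on S \<psi>" and x: "x \<in> S" and z: "z \<in> S" and ex: "expands_at \<psi> x v M"
  shows "\<psi> x + v \<bullet> (z - x) \<le> \<psi> z"
proof -
  define h where "h = z - x"
  obtain \<tau> where \<tau>: "\<tau> > 0" "\<And>t. 0 < t \<Longrightarrow> t < \<tau> \<Longrightarrow>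
       \<bar>\<psi> (x + t *\<^sub>R h) - \<psi> x - t * (v \<bullet> h) - t\<^sup>2 * (h \<bullet> (M *v h)) / 2\<bar> \<le> 1 * t\<^sup>2"
    using expands_at_along_ray[OF ex, of 1 h] by auto
  have step: "v \<bullet> h + t * ((h \<bullet> (M *v h)) / 2 - 1) \<le> \<psi> z - \<psi> x" if t: "0 < t" "t < min \<tau> 1" for t
  proof -
    have "\<psi> ((1 - t) *\<^sub>R x + t *\<^sub>R z) \<le> (1 - t) * \<psi> x + t * \<psi> z"
      using cvx x z t by (intro convex_onD) auto
    moreover have "(1 - t) *\<^sub>R x + t *\<^sub>R z = x + t *\<^sub>R h" by (simp add: h_def algebra_simps)
    ultimately have "\<psi> (x + t *\<^sub>R h) - \<psi> x \<le> t * (\<psi> z - \<psi> x)" by (simp add: algebra_simps)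
    moreover have "\<psi> (x + t *\<^sub>R h) - \<psi> x \<ge> t * (v \<bullet> h) + t\<^sup>2 * (h \<bullet> (M *v h)) / 2 - t\<^sup>2"
      using \<tau>(2)[of t] t by (simp add: abs_le_iff)
    ultimately have "t * (v \<bullet> h + t * ((h \<bullet> (M *v h)) / 2 - 1)) \<le> t * (\<psi> z - \<psi> x)"
      by (simp add: algebra_simps power2_eq_square)
    then show ?thesis using t by simp
  qed
  have "v \<bullet> h \<le> \<psi> z - \<psi> x" by (rule le_of_small_linear_le[of "min \<tau> 1", OF _ step]) (simp_all add: \<tau>(1))
  then show ?thesis by (simp add: h_def)
qed

lemma convex_on_expands_at_psd:
  assumes cvx: "convex_on S \<psi>" and x: "x \<in> interior S" and ex: "expands_at \<psi> x v M"
  shows "0 \<le> h \<bullet> (M *v h)"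
proof -
  obtain r where r: "r > 0" "ball x r \<subseteq> S" using x by (auto simp: mem_interior)
  have xS: "x \<in> S" using x interior_subset by blast
  have step: "- e \<le> (h \<bullet> (M *v h)) / 2" if e: "e > 0" for e :: real
  proof -
    obtain \<tau> where \<tau>: "\<tau> > 0" "\<And>t. 0 < t \<Longrightarrow> t < \<tau> \<Longrightarrow>
       \<bar>\<psi> (x + t *\<^sub>R h) - \<psi> x - t * (v \<bullet> h) - t\<^sup>2 * (h \<bullet> (M *v h)) / 2\<bar> \<le> e * t\<^sup>2"
      using expands_at_along_ray[OF ex e] by metis
    define t where "t = min (\<tau> / 2) (r / (2 * (1 + norm h)))"
    have t: "0 < t" "t < \<tau>" "t \<le> r / (2 * (1 + norm h))"
      using \<tau>(1) r(1) by (auto simp: t_def add_pos_nonneg)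
    have "t * (2 * (1 + norm h)) \<le> r"
      using t(3) by (simp add: pos_le_divide_eq add_pos_nonneg)
    moreover have "t * norm h \<ge> 0" using t(1) by simp
    moreover have "t * (2 * (1 + norm h)) = 2 * t + 2 * (t * norm h)" by (simp add: distrib_left)
    ultimately have "t * norm h < r" using t(1) by linarith
    then have "x + t *\<^sub>R h \<in> S" using r(2) t(1) by (intro subsetD[OF r(2)]) (simp add: dist_norm)
    then have "\<psi> x + t * (v \<bullet> h) \<le> \<psi> (x + t *\<^sub>R h)"
      using convex_on_ge_tangent[OF cvx xS _ ex] by fastforce
    then have "- (e * t\<^sup>2) \<le> t\<^sup>2 * (h \<bullet> (M *v h)) / 2"
      using \<tau>(2)[OF t(1,2)] by linarith
    then have "t\<^sup>2 * (- e) \<le> t\<^sup>2 * ((h \<bullet> (M *v h)) / 2)" by (simp add: mult.commute)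
    then show ?thesis using t(1) by (simp only: mult_le_cancel_left_pos zero_less_power)
  qed
  have "- ((h \<bullet> (M *v h)) / 2) \<le> 0"
  proof (rule field_le_epsilon)
    fix e :: real assume "e > 0"
    from step[OF this] show "- ((h \<bullet> (M *v h)) / 2) \<le> 0 + e" by linarith
  qed
  then show ?thesis by simp
qed

text \<open>
  A semidefinite form vanishes at \<open>h\<close> only if \<open>M h = 0\<close>, so invertibility gives
  definiteness, and compactness of the unit sphere makes it uniform.
\<close>

lemma psd_invertible_coercive:
  fixes M :: "real ^ 'n ^ 'n"
  assumes sym: "transpose M = M" and psd: "\<And>h. 0 \<le> h \<bullet> (M *v h)" and inv: "invertible M"
  obtains c where "c > 0" "\<And>h. c * (norm h)\<^sup>2 \<le> h \<bullet> (M *v h)"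
proof -
  have pd: "0 < h \<bullet> (M *v h)" if h: "h \<noteq> 0" for h
  proof (rule ccontr)
    assume "\<not> 0 < h \<bullet> (M *v h)"
    then have h0: "h \<bullet> (M *v h) = 0" using psd[of h] by linarith
    define z where "z = M *v h"
    have "z \<noteq> 0" using inv h unfolding z_def
      by (metis invertible_def matrix_vector_mul_assoc matrix_vector_mul_lid matrix_vector_mult_0_right)
    \<comment> \<open>Nonnegativity of the form at \<open>h - t z\<close>, to first order in \<open>t\<close>, forces \<open>z = 0\<close>.\<close>
    have step: "2 * (z \<bullet> z) + t * (- (z \<bullet> (M *v z))) \<le> 0" if t: "0 < t" for t
    proof -
      have "0 \<le> (h - t *\<^sub>R z) \<bullet> (M *v (h - t *\<^sub>R z))" by (rule psd)
      also have "\<dots> = t\<^sup>2 * (z \<bullet> (M *v z)) - 2 * t * (z \<bullet> z)"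
        using h0 symmetric_matrix_inner[OF sym, of h z]
        by (simp add: matrix_vector_mult_diff_distrib matrix_vector_mult_scaleR inner_diff_left
            inner_diff_right z_def[symmetric] power2_eq_square algebra_simps inner_commute)
      finally have "t * (2 * (z \<bullet> z) + t * (- (z \<bullet> (M *v z)))) \<le> t * 0"
        by (simp add: power2_eq_square algebra_simps)
      then show ?thesis using t by (simp only: mult_le_cancel_left_pos)
    qed
    have "2 * (z \<bullet> z) \<le> 0" by (rule le_of_small_linear_le[OF zero_less_one step])
    moreover have "z \<bullet> z > 0" using \<open>z \<noteq> 0\<close> by simp
    ultimately show False by simp
  qed
  let ?q = "\<lambda>h. h \<bullet> (M *v h)"
  have cont: "continuous_on (sphere 0 1) ?q"
    by (intro continuous_intros linear_continuous_on) simp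
  have ne: "sphere (0 :: real ^ 'n) 1 \<noteq> {}" using vector_choose_size[of 1] by force
  obtain a where a: "a \<in> sphere 0 1" "\<And>h. h \<in> sphere 0 1 \<Longrightarrow> ?q a \<le> ?q h"
    using continuous_attains_inf[OF compact_sphere ne cont] by blast
  show thesis
  proof (rule that[of "?q a"])
    show "?q a > 0" using a(1) by (intro pd) auto
    fix h
    show "?q a * (norm h)\<^sup>2 \<le> ?q h"
    proof (cases "h = 0")
      case False
      have "?q a \<le> ?q ((1 / norm h) *\<^sub>R h)" using False by (intro a(2)) simp
      also have "\<dots> = ?q h / (norm h)\<^sup>2"
        by (simp add: matrix_vector_mult_scaleR power2_eq_square)
      finally show ?thesis using False by (simp add: pos_le_divide_eq)
    qed simp
  qed
qed

text \<open>
  A second-order expansion of \<open>\<psi>\<close> at \<open>x0\<close> differentiates: subgradients at nearby points of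
  an arbitrary set \<open>X\<close> are \<open>p x0 + M h + o(h)\<close>, although the gradient need not exist in a
  neighbourhood.
\<close>

lemma has_derivative_subgradient:
  fixes p :: "real ^ 'n \<Rightarrow> real ^ 'n"
  assumes x0: "x0 \<in> interior S" and ex: "expands_at \<psi> x0 (p x0) M" and sym: "transpose M = M"
    and sub: "\<And>x z. x \<in> X \<Longrightarrow> z \<in> S \<Longrightarrow> \<psi> x + p x \<bullet> (z - x) \<le> \<psi> z"
  shows "(p has_derivative (\<lambda>h. M *v h)) (at x0 within X)"
  unfolding has_derivative_within_alt
proof (intro conjI allI impI)
  show "bounded_linear (\<lambda>h. M *v h)" by simp
  fix e :: real assume e: "e > 0"
  define C where "C = onorm ((*v) M)"
  have C: "C \<ge> 0" unfolding C_def by (rule onorm_pos_le) simp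
  define t where "t = min 1 (e / (C / 2 + 5))"
  have t: "t > 0" "t \<le> 1" "t * (C / 2 + 5) \<le> e"
  proof -
    show "t > 0" "t \<le> 1" using e C by (auto simp: t_def)
    have "t \<le> e / (C / 2 + 5)" by (simp add: t_def)
    then show "t * (C / 2 + 5) \<le> e" using C by (simp add: pos_le_divide_eq)
  qed
  then have "t\<^sup>2 > 0" by simp
  then obtain \<delta> where \<delta>: "\<delta> > 0" "\<And>h. norm h < \<delta> \<Longrightarrow>
      \<bar>\<psi> (x0 + h) - \<psi> x0 - p x0 \<bullet> h - (h \<bullet> (M *v h)) / 2\<bar> \<le> t\<^sup>2 * (norm h)\<^sup>2"
    using ex unfolding expands_at_def by meson
  obtain r where r: "r > 0" "ball x0 r \<subseteq> S" using x0 by (auto simp: mem_interior)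
  have "norm (p x - p x0 - M *v (x - x0)) \<le> e * norm (x - x0)"
    if xX: "x \<in> X" and xd: "norm (x - x0) < min \<delta> r / 2" for x
  proof -
    define h where "h = x - x0"
    define u where "u = p x - p x0 - M *v h"
    have x: "x = x0 + h" by (simp add: h_def)
    have hd: "norm h < \<delta> / 2" "norm h < r / 2" using xd by (auto simp: h_def)
    show ?thesis
    proof (cases "u = 0 \<or> h = 0")
      case True
      then show ?thesis using e by (auto simp: u_def h_def)
    next
      case False
      \<comment> \<open>Testing the subgradient inequality in the direction of the error \<open>u\<close>, at a step short compared with \<open>h\<close>, bounds \<open>u\<close>.\<close>
      define w where "w = (t * norm h / norm u) *\<^sub>R u"
      have nw: "norm w = t * norm h" using False t by (simp add: w_def)
      then have nwh: "norm w \<le> norm h" using t by (simp add: mult_left_le_one_le)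
      then have nhw: "norm (h + w) \<le> 2 * norm h" using norm_triangle_ineq[of h w] by linarith
      have "dist x0 (x + w) = norm (h + w)" using norm_minus_cancel[of "h + w"] by (simp add: x dist_norm)
      then have "x + w \<in> S" using nhw hd(2) by (intro subsetD[OF r(2)]) simp
      then have "\<psi> (x0 + h) + p x \<bullet> w \<le> \<psi> (x0 + (h + w))"
        using sub[OF xX, of "x + w"] by (simp add: x add.assoc)
      moreover have "\<psi> (x0 + (h + w)) \<le> \<psi> x0 + p x0 \<bullet> (h + w) + ((h + w) \<bullet> (M *v (h + w))) / 2
          + t\<^sup>2 * (norm (h + w))\<^sup>2"
        using \<delta>(2)[of "h + w"] nhw hd(1) by (simp add: abs_le_iff)
      moreover have "\<psi> (x0 + h) \<ge> \<psi> x0 + p x0 \<bullet> h + (h \<bullet> (M *v h)) / 2 - t\<^sup>2 * (norm h)\<^sup>2"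
        using \<delta>(2)[of h] \<delta>(1) hd(1) by (simp add: abs_le_iff)
      moreover have "(h + w) \<bullet> (M *v (h + w)) = h \<bullet> (M *v h) + 2 * ((M *v h) \<bullet> w) + w \<bullet> (M *v w)"
        using symmetric_matrix_inner[OF sym, of h w]
        by (simp add: matrix_vector_right_distrib inner_add_left inner_add_right inner_commute)
      ultimately have "u \<bullet> w \<le> (w \<bullet> (M *v w)) / 2 + t\<^sup>2 * (norm (h + w))\<^sup>2 + t\<^sup>2 * (norm h)\<^sup>2"
        unfolding u_def inner_diff_left inner_add_right by linarith
      also have "\<dots> \<le> C * (t * norm h)\<^sup>2 / 2 + t\<^sup>2 * (2 * norm h)\<^sup>2 + t\<^sup>2 * (norm h)\<^sup>2"
      proof -
        have "w \<bullet> (M *v w) \<le> C * (t * norm h)\<^sup>2"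
          using quadratic_form_le[of w M] by (simp add: C_def nw abs_le_iff)
        moreover have "t\<^sup>2 * (norm (h + w))\<^sup>2 \<le> t\<^sup>2 * (2 * norm h)\<^sup>2"
          using nhw by (intro mult_left_mono power_mono) auto
        ultimately show ?thesis by linarith
      qed
      also have "\<dots> = (t * norm h) * (t * (C / 2 + 5) * norm h)"
        by (simp add: power_mult_distrib power2_eq_square algebra_simps)
      also have "\<dots> \<le> (t * norm h) * (e * norm h)"
        using t by (intro mult_left_mono mult_right_mono) auto
      finally have "u \<bullet> w \<le> (t * norm h) * (e * norm h)" .
      moreover have "u \<bullet> w = (t * norm h) * norm u"
        using False by (simp add: w_def dot_square_norm power2_eq_square)
      ultimately have "(t * norm h) * norm u \<le> (t * norm h) * (e * norm h)" by simp
      moreover have "t * norm h > 0" using t False by simp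
      ultimately have "norm u \<le> e * norm h" by (simp only: mult_le_cancel_left_pos)
      then show ?thesis by (simp add: u_def h_def)
    qed
  qed
  moreover have "min \<delta> r / 2 > 0" using \<delta>(1) r(1) by simp
  ultimately show "\<exists>d>0. \<forall>x\<in>X. norm (x - x0) < d \<longrightarrow>
      norm (p x - p x0 - M *v (x - x0)) \<le> e * norm (x - x0)"
    by blast
qed

section \<open>Second-order expansion of the dual function\<close>

text \<open>
  The scalar identity behind the local duality. With \<open>\<psi>\<close> expanded at \<open>x0\<close> and \<open>\<eta>\<close> at \<open>y0\<close>,
  and \<open>p0 = \<psi> x0\<close>, \<open>u = x0 \<bullet> v\<close>, \<open>d = v \<bullet> h\<close>, \<open>a = x0 \<bullet> k\<close>, \<open>p = h \<bullet> k\<close>, where \<open>A\<close> and \<open>B\<close>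
  are the two quadratic forms and \<open>r\<close>, \<open>e\<close> the two remainders, the terms of order zero and
  one in \<open>\<psi> + \<eta> - s \<psi> \<eta> - x \<bullet> y\<close> cancel.
\<close>

lemma dual_completed_square:
  fixes s p0 u d a A B p r e g m :: real
  assumes g: "g = 1 - s * p0" and m: "m = g + s * u" and nz: "g \<noteq> 0" "m \<noteq> 0"
  shows "(p0 + (d + A / 2 + r)) + ((u - p0) / m + (a / g + B / 2 + e))
      - s * (p0 + (d + A / 2 + r)) * ((u - p0) / m + (a / g + B / 2 + e)) - (u / m + a + d / m + p)
    = (A - 2 * m * (p + s / g * a * d) + m * g * B) / (2 * m)
      + r / m + g * e - s * ((d + A / 2 + r) * (a / g + B / 2 + e) - d * (a / g))"
proof -
  define w0 where "w0 = (u - p0) / m"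
  define \<alpha> where "\<alpha> = d + A / 2 + r"
  define \<beta> where "\<beta> = a / g + B / 2 + e"
  have w0: "1 - s * w0 = 1 / m"
    using nz(2) by (simp add: w0_def field_simps) (simp add: m g algebra_simps)
  have "(p0 + \<alpha>) + (w0 + \<beta>) - s * (p0 + \<alpha>) * (w0 + \<beta>) - (u / m + a + d / m + p)
    = (p0 * (1 - s * w0) + w0 - u / m) + \<alpha> * (1 - s * w0) + \<beta> * (1 - s * p0) - s * (\<alpha> * \<beta>) - a - d / m - p"
    by (simp add: algebra_simps)
  also have "p0 * (1 - s * w0) + w0 - u / m = 0"
    unfolding w0 by (simp add: w0_def diff_divide_distrib)
  also have "\<alpha> * (1 - s * w0) = d / m + A / (2 * m) + r / m"
    unfolding w0 by (simp add: \<alpha>_def add_divide_distrib)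
  also have "\<beta> * (1 - s * p0) = a + g * B / 2 + g * e"
    unfolding g[symmetric] using nz(1) by (simp add: \<beta>_def field_simps)
  finally have *: "(p0 + \<alpha>) + (w0 + \<beta>) - s * (p0 + \<alpha>) * (w0 + \<beta>) - (u / m + a + d / m + p)
    = A / (2 * m) + r / m + g * B / 2 + g * e - p - s * (\<alpha> * \<beta>)" by simp
  have "(A - 2 * m * (p + s / g * a * d) + m * g * B) / (2 * m) = A / (2 * m) - (p + s / g * a * d) + g * B / 2"
    using nz(2) by (simp add: add_divide_distrib diff_divide_distrib)
  then show ?thesis
    unfolding * w0_def[symmetric] \<alpha>_def[symmetric] \<beta>_def[symmetric]
    by (simp add: algebra_simps)
qed

lemma product_remainder_bound:
  fixes \<alpha> d \<beta> b h k \<rho> C1 C2 V W :: real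
  assumes \<alpha>: "\<bar>\<alpha> - d\<bar> \<le> C1 * h\<^sup>2" and \<beta>: "\<bar>\<beta> - b\<bar> \<le> C2 * k\<^sup>2"
    and d: "\<bar>d\<bar> \<le> V * h" and b: "\<bar>b\<bar> \<le> W * k"
    and h: "0 \<le> h" "h \<le> \<rho>" and k: "0 \<le> k" "k \<le> \<rho>" and \<rho>: "\<rho> \<le> 1"
    and nn: "0 \<le> C1" "0 \<le> C2" "0 \<le> V" "0 \<le> W"
  shows "\<bar>\<alpha> * \<beta> - d * b\<bar> \<le> \<rho> * (C1 * (W + C2) + V * C2) * (h\<^sup>2 + k\<^sup>2)"
proof -
  have k1: "k\<^sup>2 \<le> k" using k \<rho> by (simp add: power2_eq_square mult_left_le)
  have "\<bar>\<beta>\<bar> \<le> W * k + C2 * k\<^sup>2" using \<beta> b by linarith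
  also have "\<dots> \<le> W * k + C2 * k" using k1 nn by (intro add_left_mono mult_left_mono)
  also have "\<dots> \<le> (W + C2) * \<rho>" using k nn by (simp add: mult_left_mono flip: distrib_right)
  finally have \<beta>': "\<bar>\<beta>\<bar> \<le> (W + C2) * \<rho>" .
  have d': "\<bar>d\<bar> \<le> V * \<rho>" using d h nn by (meson mult_left_mono order_trans)
  have "\<alpha> * \<beta> - d * b = (\<alpha> - d) * \<beta> + d * (\<beta> - b)" by (simp add: algebra_simps)
  then have "\<bar>\<alpha> * \<beta> - d * b\<bar> \<le> \<bar>\<alpha> - d\<bar> * \<bar>\<beta>\<bar> + \<bar>d\<bar> * \<bar>\<beta> - b\<bar>"
    by (metis abs_mult abs_triangle_ineq)
  also have "\<dots> \<le> (C1 * h\<^sup>2) * ((W + C2) * \<rho>) + (V * \<rho>) * (C2 * k\<^sup>2)"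
    using \<alpha> \<beta> \<beta>' d' nn h k by (intro add_mono mult_mono) auto
  also have "\<dots> \<le> (\<rho> * (C1 * (W + C2) + V * C2)) * h\<^sup>2 + (\<rho> * (C1 * (W + C2) + V * C2)) * k\<^sup>2"
  proof (rule add_mono)
    have "\<rho> \<ge> 0" using h by linarith
    then have "0 \<le> \<rho> * (V * C2) * h\<^sup>2" "0 \<le> \<rho> * (C1 * (W + C2)) * k\<^sup>2" using nn by auto
    then show "(C1 * h\<^sup>2) * ((W + C2) * \<rho>) \<le> (\<rho> * (C1 * (W + C2) + V * C2)) * h\<^sup>2"
      and "(V * \<rho>) * (C2 * k\<^sup>2) \<le> (\<rho> * (C1 * (W + C2) + V * C2)) * k\<^sup>2"
      by (simp_all add: algebra_simps)
  qed
  finally show ?thesis by (simp add: distrib_left)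
qed

lemma norm_sq_le_twice:
  fixes a b :: "'a::real_inner"
  shows "(norm a)\<^sup>2 \<le> 2 * (norm (a - b))\<^sup>2 + 2 * (norm b)\<^sup>2"
proof -
  have "(norm a)\<^sup>2 \<le> (norm (a - b) + norm b)\<^sup>2"
    using norm_triangle_ineq[of "a - b" b] by (intro power_mono) auto
  also have "\<dots> \<le> 2 * (norm (a - b))\<^sup>2 + 2 * (norm b)\<^sup>2"
    using sum_squares_bound[of "norm (a - b)" "norm b"] by (simp add: power2_sum)
  finally show ?thesis .
qed

text \<open>
  Local duality. The dual function \<open>\<eta>\<close> of \<open>\<psi>\<close> is characterised by \<open>D1\<close> and \<open>D2\<close>: for
  \<open>s w < 1\<close>, the bound \<open>\<eta> y \<le> w\<close> means that \<open>\<Phi> x y w = \<psi> x + w - s \<psi> x w - x \<bullet> y\<close> is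
  nonnegative for all \<open>x \<in> S\<close>. If \<open>\<psi>\<close> has an expansion at \<open>x0\<close> with positive definite
  matrix \<open>M\<close>, then the second-order part of \<open>\<Phi>\<close> at \<open>x0 + h\<close>, \<open>y0 + k\<close> is
  \<open>(h - H k) \<bullet> M (h - H k) / (2 m)\<close> for a linear map \<open>H\<close>, if \<open>w\<close> is given by the asserted
  expansion of \<open>\<eta>\<close>. Raising \<open>w\<close> by \<open>\<epsilon> |k|\<^sup>2\<close> makes \<open>\<Phi>\<close> nonnegative, first near \<open>x0\<close> and by
  convexity on all of \<open>S\<close>; lowering \<open>w\<close> by \<open>\<epsilon> |k|\<^sup>2\<close> makes it nonpositive at \<open>h = H k\<close>.
\<close>

lemma dual_expands_at:
  fixes \<psi> \<eta> :: "real ^ 'n \<Rightarrow> real"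
  assumes s: "s > 0" and cvx: "convex_on S \<psi>" and pos: "\<And>x. x \<in> S \<Longrightarrow> s * \<psi> x < 1"
    and D1: "\<And>x y. x \<in> S \<Longrightarrow> y \<in> Sd \<Longrightarrow> x \<bullet> y + s * \<psi> x * \<eta> y \<le> \<psi> x + \<eta> y"
    and D2: "\<And>y w. s * w < 1 \<Longrightarrow> (\<And>x. x \<in> S \<Longrightarrow> x \<bullet> y + s * \<psi> x * w \<le> \<psi> x + w) \<Longrightarrow> y \<in> Sd \<and> \<eta> y \<le> w"
    and x0: "x0 \<in> interior S" and ex: "expands_at \<psi> x0 v M" and sym: "transpose M = M"
    and c: "c > 0" "\<And>h. c * (norm h)\<^sup>2 \<le> h \<bullet> (M *v h)"
    and g: "g = 1 - s * \<psi> x0" and m: "m = g + s * (x0 \<bullet> v)" and m0: "m > 0"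
    and HM: "\<And>k. M *v (H *v k) = m *\<^sub>R (k + (s / g * (x0 \<bullet> k)) *\<^sub>R v)"
    and Md: "\<And>k. m * g * (k \<bullet> (Md *v k)) = (H *v k) \<bullet> (M *v (H *v k))"
  shows "(1 / m) *\<^sub>R v \<in> interior Sd" (is "?y0 \<in> _")
    and "\<eta> ((1 / m) *\<^sub>R v) = (x0 \<bullet> v - \<psi> x0) / m"
    and "expands_at \<eta> ((1 / m) *\<^sub>R v) ((1 / g) *\<^sub>R x0) Md"
proof -
  have xS: "x0 \<in> S" using x0 interior_subset by blast
  have g0: "g > 0" using pos[OF xS] by (simp add: g)
  define \<eta>0 where "\<eta>0 = (x0 \<bullet> v - \<psi> x0) / m"
  define Q where "Q k = k \<bullet> (Md *v k)" for k
  define lin where "lin k = (x0 \<bullet> k) / g" for k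
  define \<Phi> where "\<Phi> x y w = \<psi> x + w - s * \<psi> x * w - x \<bullet> y" for x y w
  define rem where "rem h = \<psi> (x0 + h) - \<psi> x0 - v \<bullet> h - (h \<bullet> (M *v h)) / 2" for h
  have \<eta>0': "1 - s * \<eta>0 = 1 / m"
    using m0 by (simp add: \<eta>0_def field_simps) (simp add: m g algebra_simps)
  have square: "(h - H *v k) \<bullet> (M *v (h - H *v k)) =
      h \<bullet> (M *v h) - 2 * m * (h \<bullet> k + s / g * (x0 \<bullet> k) * (v \<bullet> h)) + m * g * Q k" for h k
  proof -
    have "(h - H *v k) \<bullet> (M *v (h - H *v k))
        = h \<bullet> (M *v h) - 2 * (h \<bullet> (M *v (H *v k))) + (H *v k) \<bullet> (M *v (H *v k))"
      using symmetric_matrix_inner[OF sym, of h "H *v k"]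
      by (simp add: matrix_vector_mult_diff_distrib inner_diff_left inner_diff_right inner_commute)
    also have "(H *v k) \<bullet> (M *v (H *v k)) = m * g * Q k" by (simp add: Q_def Md)
    also have "h \<bullet> (M *v (H *v k)) = m * (h \<bullet> k + s / g * (x0 \<bullet> k) * (v \<bullet> h))"
      by (simp add: HM inner_add_right inner_commute)
    finally show ?thesis by simp
  qed
  have expansion: "\<Phi> (x0 + h) (?y0 + k) (\<eta>0 + lin k + Q k / 2 + e) =
      ((h - H *v k) \<bullet> (M *v (h - H *v k))) / (2 * m) + rem h / m + g * e
      - s * ((v \<bullet> h + (h \<bullet> (M *v h)) / 2 + rem h) * (lin k + Q k / 2 + e) - (v \<bullet> h) * lin k)" for h k e
  proof -
    have 1: "\<psi> (x0 + h) = \<psi> x0 + (v \<bullet> h + (h \<bullet> (M *v h)) / 2 + rem h)" by (simp add: rem_def)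
    have 2: "(x0 + h) \<bullet> (?y0 + k) = (x0 \<bullet> v) / m + x0 \<bullet> k + (v \<bullet> h) / m + h \<bullet> k"
      by (simp add: inner_add_left inner_add_right inner_commute add_divide_distrib)
    show ?thesis
      unfolding \<Phi>_def 1 2 square lin_def \<eta>0_def
      using dual_completed_square[OF g m, of "v \<bullet> h" "h \<bullet> (M *v h)" "rem h" "x0 \<bullet> k" "Q k" e "h \<bullet> k"] g0 m0
      by (simp add: add.assoc)
  qed
  define C where "C = onorm ((*v) M)"
  define Cd where "Cd = onorm ((*v) Md)"
  define L where "L = onorm ((*v) H)"
  have nn: "C \<ge> 0" "Cd \<ge> 0" "L \<ge> 0" unfolding C_def Cd_def L_def by (auto intro: onorm_pos_le)
  have qM: "\<bar>h \<bullet> (M *v h)\<bar> \<le> C * (norm h)\<^sup>2" for h unfolding C_def by (rule quadratic_form_le)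
  have qQ: "\<bar>Q k\<bar> \<le> Cd * (norm k)\<^sup>2" for k unfolding Cd_def Q_def by (rule quadratic_form_le)
  have nH: "norm (H *v k) \<le> L * norm k" for k unfolding L_def by (intro onorm) simp
  have nH2: "(norm (H *v k))\<^sup>2 \<le> L\<^sup>2 * (norm k)\<^sup>2" for k
    using power_mono[OF nH, of k 2] by (simp add: power_mult_distrib)
  have linb: "\<bar>lin k\<bar> \<le> (norm x0 / g) * norm k" for k
    using Cauchy_Schwarz_ineq2[of x0 k] g0 by (simp add: lin_def abs_divide divide_right_mono)
  define K where "K = (C / 2 + 1) * (norm x0 / g + (Cd / 2 + 1)) + norm v * (Cd / 2 + 1)"
  have K0: "K \<ge> 0" using nn g0 by (simp add: K_def)
  \<comment> \<open>Up to \<open>\<tau> (|h|\<^sup>2 + |k|\<^sup>2)\<close>, the function \<open>\<Phi>\<close> is the completed square plus the shift \<open>g e\<close>.\<close>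
  have estimate: "\<exists>\<rho>. 0 < \<rho> \<and> \<rho> \<le> 1 \<and> (\<forall>h k e. norm h \<le> \<rho> \<longrightarrow> norm k \<le> \<rho> \<longrightarrow> \<bar>e\<bar> \<le> (norm k)\<^sup>2 \<longrightarrow>
      \<bar>\<Phi> (x0 + h) (?y0 + k) (\<eta>0 + lin k + Q k / 2 + e)
        - ((h - H *v k) \<bullet> (M *v (h - H *v k))) / (2 * m) - g * e\<bar> \<le> \<tau> * ((norm h)\<^sup>2 + (norm k)\<^sup>2))"
    if \<tau>: "\<tau> > 0" for \<tau>
  proof -
    have "min 1 (m * \<tau> / 2) > 0" using \<tau> m0 by simp
    then obtain \<delta> where \<delta>: "\<delta> > 0" "\<And>h. norm h < \<delta> \<Longrightarrow> \<bar>rem h\<bar> \<le> min 1 (m * \<tau> / 2) * (norm h)\<^sup>2"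
      using ex unfolding expands_at_def rem_def by meson
    have sK: "2 * s * K \<ge> 0" using s K0 by simp
    define D where "D = 2 * s * K + 1"
    have D: "D > 0" using sK unfolding D_def by linarith
    define \<rho> where "\<rho> = min (min 1 (\<delta> / 2)) (\<tau> / D)"
    have \<rho>: "0 < \<rho>" "\<rho> \<le> 1" "\<rho> < \<delta>" "\<rho> \<le> \<tau> / D"
      using \<delta>(1) \<tau> D by (auto simp: \<rho>_def min_less_iff_disj)
    have \<rho>K: "s * (\<rho> * K) \<le> \<tau> / 2"
    proof -
      have "\<rho> * D \<le> \<tau>" using \<rho>(4) D by (simp add: pos_le_divide_eq)
      then show ?thesis using \<rho>(1) by (simp add: D_def algebra_simps)
    qed
    show ?thesis
    proof (intro exI[of _ \<rho>] conjI allI impI \<rho>(1,2))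
      fix h k :: "real ^ 'n" and e :: real
      assume h: "norm h \<le> \<rho>" and k: "norm k \<le> \<rho>" and e: "\<bar>e\<bar> \<le> (norm k)\<^sup>2"
      define \<alpha> where "\<alpha> = v \<bullet> h + (h \<bullet> (M *v h)) / 2 + rem h"
      define \<beta> where "\<beta> = lin k + Q k / 2 + e"
      have r: "\<bar>rem h\<bar> \<le> min 1 (m * \<tau> / 2) * (norm h)\<^sup>2" using \<delta>(2)[of h] h \<rho>(3) by simp
      have r1: "\<bar>rem h\<bar> \<le> (norm h)\<^sup>2"
        using r mult_right_mono[of "min 1 (m * \<tau> / 2)" 1 "(norm h)\<^sup>2"] by simp
      have "\<bar>rem h\<bar> \<le> m * \<tau> / 2 * (norm h)\<^sup>2"
        using r by (rule order_trans) (intro mult_right_mono, auto)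
      then have r2: "\<bar>rem h / m\<bar> \<le> \<tau> / 2 * (norm h)\<^sup>2"
        using m0 by (simp add: abs_divide pos_divide_le_eq mult_ac)
      have "\<bar>\<alpha> * \<beta> - (v \<bullet> h) * lin k\<bar> \<le> \<rho> * K * ((norm h)\<^sup>2 + (norm k)\<^sup>2)"
        unfolding K_def
      proof (rule product_remainder_bound)
        show "\<bar>\<alpha> - v \<bullet> h\<bar> \<le> (C / 2 + 1) * (norm h)\<^sup>2"
          using qM[of h] r1 by (simp add: \<alpha>_def distrib_right)
        show "\<bar>\<beta> - lin k\<bar> \<le> (Cd / 2 + 1) * (norm k)\<^sup>2"
          using qQ[of k] e by (simp add: \<beta>_def distrib_right)
      qed (use Cauchy_Schwarz_ineq2 linb h k \<rho> nn g0 in auto)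
      then have "s * \<bar>\<alpha> * \<beta> - (v \<bullet> h) * lin k\<bar> \<le> s * (\<rho> * K * ((norm h)\<^sup>2 + (norm k)\<^sup>2))"
        using s by (intro mult_left_mono) auto
      also have "\<dots> = (s * (\<rho> * K)) * ((norm h)\<^sup>2 + (norm k)\<^sup>2)" by simp
      also have "\<dots> \<le> \<tau> / 2 * ((norm h)\<^sup>2 + (norm k)\<^sup>2)"
        using \<rho>K by (intro mult_right_mono) auto
      finally have "\<bar>s * (\<alpha> * \<beta> - (v \<bullet> h) * lin k)\<bar> \<le> \<tau> / 2 * ((norm h)\<^sup>2 + (norm k)\<^sup>2)"
        using s by (simp add: abs_mult)
      moreover have "\<tau> * ((norm h)\<^sup>2 + (norm k)\<^sup>2) \<ge> \<tau> / 2 * ((norm h)\<^sup>2 + (norm k)\<^sup>2) + \<tau> / 2 * (norm h)\<^sup>2"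
        using \<tau> by (simp add: algebra_simps)
      ultimately show "\<bar>\<Phi> (x0 + h) (?y0 + k) (\<eta>0 + lin k + Q k / 2 + e)
          - ((h - H *v k) \<bullet> (M *v (h - H *v k))) / (2 * m) - g * e\<bar> \<le> \<tau> * ((norm h)\<^sup>2 + (norm k)\<^sup>2)"
        using r2 unfolding expansion \<alpha>_def[symmetric] \<beta>_def[symmetric] by linarith
    qed
  qed
  have main: "\<exists>\<kappa>>0. \<forall>k. norm k < \<kappa> \<longrightarrow> ?y0 + k \<in> Sd \<and> \<bar>\<eta> (?y0 + k) - \<eta>0 - lin k - Q k / 2\<bar> \<le> \<epsilon> * (norm k)\<^sup>2"
    if \<epsilon>: "\<epsilon> > 0" for \<epsilon>
  proof -
    define \<epsilon>' where "\<epsilon>' = min \<epsilon> 1"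
    have \<epsilon>': "\<epsilon>' > 0" "\<epsilon>' \<le> 1" "\<epsilon>' \<le> \<epsilon>" using \<epsilon> by (auto simp: \<epsilon>'_def)
    define c' where "c' = c / (2 * m)"
    have c': "c' > 0" using c m0 by (simp add: c'_def)
    have quad: "c' * (norm z)\<^sup>2 \<le> (z \<bullet> (M *v z)) / (2 * m)" for z
      using c(2)[of z] m0 by (simp add: c'_def divide_right_mono)
    define \<tau> where "\<tau> = min (c' / 4) (g * \<epsilon>' / (2 * L\<^sup>2 + 1))"
    have L1: "2 * L\<^sup>2 + 1 > 0" by (simp add: add_nonneg_pos)
    have \<tau>: "\<tau> > 0" "\<tau> \<le> c' / 4" "\<tau> * (2 * L\<^sup>2 + 1) \<le> g * \<epsilon>'"
    proof -
      show "\<tau> > 0" using c' g0 \<epsilon>' L1 by (simp add: \<tau>_def)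
      show "\<tau> \<le> c' / 4" unfolding \<tau>_def by (rule min.cobounded1)
      have "\<tau> \<le> g * \<epsilon>' / (2 * L\<^sup>2 + 1)" by (simp add: \<tau>_def)
      then show "\<tau> * (2 * L\<^sup>2 + 1) \<le> g * \<epsilon>'" using L1 by (simp add: pos_le_divide_eq)
    qed
    have \<tau>g: "\<tau> \<le> g * \<epsilon>'"
    proof -
      have "\<tau> * 1 \<le> \<tau> * (2 * L\<^sup>2 + 1)" using \<tau>(1) by (intro mult_left_mono) auto
      then show ?thesis using \<tau>(3) by linarith
    qed
    obtain \<rho> where \<rho>: "0 < \<rho>" "\<rho> \<le> 1" and est: "\<And>h k e. norm h \<le> \<rho> \<Longrightarrow> norm k \<le> \<rho> \<Longrightarrow> \<bar>e\<bar> \<le> (norm k)\<^sup>2 \<Longrightarrow>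
      \<bar>\<Phi> (x0 + h) (?y0 + k) (\<eta>0 + lin k + Q k / 2 + e)
        - ((h - H *v k) \<bullet> (M *v (h - H *v k))) / (2 * m) - g * e\<bar> \<le> \<tau> * ((norm h)\<^sup>2 + (norm k)\<^sup>2)"
      using estimate[OF \<tau>(1)] by meson
    obtain r where r: "r > 0" "ball x0 r \<subseteq> S" using x0 by (auto simp: mem_interior)
    define \<sigma> where "\<sigma> = min \<rho> (r / 2)"
    have \<sigma>: "0 < \<sigma>" "\<sigma> \<le> \<rho>" "\<sigma> < r" using \<rho> r(1) by (auto simp: \<sigma>_def)
    have inS: "x0 + h \<in> S" if "norm h \<le> \<sigma>" for h
      using that \<sigma>(3) by (intro subsetD[OF r(2)]) (simp add: dist_norm)
    define E where "E = c' * L\<^sup>2 + g * (Cd / 2 + 1)"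
    have E0: "E > 0" using c' g0 nn by (simp add: E_def add_nonneg_pos)
    define W where "W = s * m * (norm x0 / g + (Cd / 2 + 1))"
    have W0: "W > 0" using s m0 g0 nn by (auto simp: W_def intro!: mult_pos_pos add_nonneg_pos)
    \<comment> \<open>In this order, the bounds keep \<open>k\<close> within range of the estimate, \<open>x0 + H k\<close> within \<open>S\<close>, \<open>s w\<close> below one, and the centre below the sphere.\<close>
    define \<kappa> where "\<kappa> = Min {\<rho>, \<sigma> / (L + 1), 1 / W, sqrt (c' / 4 * \<sigma>\<^sup>2 / E)}"
    have \<kappa>: "\<kappa> > 0" "\<kappa> \<le> \<rho>" "\<kappa> \<le> \<sigma> / (L + 1)" "\<kappa> \<le> 1 / W" "\<kappa> \<le> sqrt (c' / 4 * \<sigma>\<^sup>2 / E)"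
      using \<rho> \<sigma> nn W0 E0 c' by (auto simp: \<kappa>_def)
    have "?y0 + k \<in> Sd \<and> \<bar>\<eta> (?y0 + k) - \<eta>0 - lin k - Q k / 2\<bar> \<le> \<epsilon> * (norm k)\<^sup>2" if k: "norm k < \<kappa>" for k
    proof -
      define N where "N = (norm k)\<^sup>2"
      have N0: "N \<ge> 0" by (simp add: N_def)
      have k\<rho>: "norm k \<le> \<rho>" using k \<kappa>(2) by linarith
      have eN: "\<bar>\<epsilon>' * N\<bar> \<le> (norm k)\<^sup>2" "\<bar>- (\<epsilon>' * N)\<bar> \<le> (norm k)\<^sup>2"
        using \<epsilon>' N0 by (auto simp: N_def mult_left_le_one_le)
      have nk1: "N \<le> norm k"
        using k\<rho> \<rho>(2) by (simp add: N_def power2_eq_square mult_left_le)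
      have EN: "E * N < c' / 4 * \<sigma>\<^sup>2"
      proof -
        have "norm k < sqrt (c' / 4 * \<sigma>\<^sup>2 / E)" using k \<kappa>(5) by linarith
        then have "N < (sqrt (c' / 4 * \<sigma>\<^sup>2 / E))\<^sup>2"
          unfolding N_def by (intro power_strict_mono) auto
        also have "\<dots> = c' / 4 * \<sigma>\<^sup>2 / E" using c' E0 by simp
        finally have "N * E < c' / 4 * \<sigma>\<^sup>2" using E0 by (simp only: pos_less_divide_eq)
        then show ?thesis by (simp only: mult.commute)
      qed
      define w where "w = \<eta>0 + lin k + Q k / 2 + \<epsilon>' * N"
      have sw: "s * w < 1"
      proof -
        have "\<bar>lin k + Q k / 2 + \<epsilon>' * N\<bar> \<le> (norm x0 / g) * norm k + (Cd / 2 + 1) * N"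
          using linb[of k] qQ[of k] eN(1) by (simp add: N_def[symmetric] distrib_right)
        also have "\<dots> \<le> (norm x0 / g) * norm k + (Cd / 2 + 1) * norm k"
          using nk1 nn by (intro add_left_mono mult_left_mono) auto
        finally have "lin k + Q k / 2 + \<epsilon>' * N \<le> (norm x0 / g + (Cd / 2 + 1)) * norm k"
          by (simp add: distrib_right)
        then have "(s * m) * (lin k + Q k / 2 + \<epsilon>' * N) \<le> (s * m) * ((norm x0 / g + (Cd / 2 + 1)) * norm k)"
          using s m0 by (intro mult_left_mono) auto
        also have "\<dots> = W * norm k" by (simp add: W_def)
        also have "\<dots> < 1"
        proof -
          have "norm k < 1 / W" using k \<kappa>(4) by linarith
          then show ?thesis using W0 by (simp add: pos_less_divide_eq mult.commute)
        qed
        finally have "s * (lin k + Q k / 2 + \<epsilon>' * N) < 1 / m"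
          using m0 by (simp add: pos_less_divide_eq mult_ac)
        then show ?thesis using \<eta>0' by (simp add: w_def distrib_left)
      qed
      have lower: "c' * (norm (h - H *v k))\<^sup>2 + g * (\<epsilon>' * N) - \<tau> * ((norm h)\<^sup>2 + N) \<le> \<Phi> (x0 + h) (?y0 + k) w"
        if h: "norm h \<le> \<sigma>" for h
        using est[of h k "\<epsilon>' * N"] h \<sigma>(2) k\<rho> eN(1) quad[of "h - H *v k"]
        unfolding w_def N_def[symmetric] by linarith
      have split: "(norm h)\<^sup>2 \<le> 2 * (norm (h - H *v k))\<^sup>2 + 2 * (L\<^sup>2 * N)" for h
        using norm_sq_le_twice[of h "H *v k"] nH2[of k] by (simp add: N_def)
      have near: "0 \<le> \<Phi> (x0 + h) (?y0 + k) w" if h: "norm h \<le> \<sigma>" for h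
      proof -
        have "\<tau> * (norm h)\<^sup>2 \<le> \<tau> * (2 * (norm (h - H *v k))\<^sup>2 + 2 * (L\<^sup>2 * N))"
          using split[of h] \<tau>(1) by (intro mult_left_mono) auto
        moreover have "(2 * \<tau>) * (norm (h - H *v k))\<^sup>2 \<le> c' * (norm (h - H *v k))\<^sup>2"
          using \<tau>(1,2) by (intro mult_right_mono) auto
        moreover have "\<tau> * (2 * L\<^sup>2 + 1) * N \<le> g * \<epsilon>' * N"
          using \<tau>(3) N0 by (rule mult_right_mono)
        ultimately show ?thesis using lower[OF h] by (simp add: algebra_simps)
      qed
      \<comment> \<open>On the sphere of radius \<open>\<sigma>\<close>, the convex function \<open>\<Phi>\<close> exceeds its value at the centre, so it cannot become negative outside the ball.\<close>
      have far: "\<Phi> x0 (?y0 + k) w < \<Phi> (x0 + h) (?y0 + k) w" if h: "norm h = \<sigma>" for h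
      proof -
        have "\<Phi> (x0 + 0) (?y0 + k) w = ((0 - H *v k) \<bullet> (M *v (0 - H *v k))) / (2 * m) + g * (\<epsilon>' * N)"
          unfolding w_def expansion by (simp add: rem_def)
        also have "((0 - H *v k) \<bullet> (M *v (0 - H *v k))) / (2 * m) = g * (Q k / 2)"
          unfolding square using m0 by simp
        finally have "\<Phi> x0 (?y0 + k) w = g * (Q k / 2 + \<epsilon>' * N)" by (simp add: distrib_left)
        also have "\<dots> \<le> g * ((Cd / 2 + 1) * N)"
          using qQ[of k] eN(1) g0 by (intro mult_left_mono) (auto simp: N_def distrib_right)
        finally have at0: "\<Phi> x0 (?y0 + k) w \<le> g * (Cd / 2 + 1) * N" by simp
        have "c' * (norm h)\<^sup>2 \<le> c' * (2 * (norm (h - H *v k))\<^sup>2 + 2 * (L\<^sup>2 * N))"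
          using split[of h] c' by (intro mult_left_mono) auto
        moreover have "\<tau> * (norm h)\<^sup>2 \<le> c' / 4 * (norm h)\<^sup>2" using \<tau>(2) by (intro mult_right_mono) auto
        moreover have "\<tau> * N \<le> g * \<epsilon>' * N" using \<tau>g N0 by (rule mult_right_mono)
        ultimately have "c' / 4 * \<sigma>\<^sup>2 - c' * L\<^sup>2 * N \<le> \<Phi> (x0 + h) (?y0 + k) w"
          using lower[of h] h by (simp add: algebra_simps)
        moreover have "E * N = c' * L\<^sup>2 * N + g * (Cd / 2 + 1) * N" by (simp add: E_def distrib_right)
        ultimately show ?thesis using at0 EN by linarith
      qed
      have \<Phi>_nonneg: "0 \<le> \<Phi> x (?y0 + k) w" if x: "x \<in> S" for x
      proof (cases "norm (x - x0) \<le> \<sigma>")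
        case True
        then show ?thesis using near[of "x - x0"] by simp
      next
        case False
        then have n: "norm (x - x0) > \<sigma>" by simp
        then have ne: "x \<noteq> x0" using \<sigma>(1) by auto
        define t where "t = \<sigma> / norm (x - x0)"
        have t: "0 < t" "t < 1" using n ne \<sigma>(1) by (auto simp: t_def divide_less_eq_1)
        define z where "z = (1 - t) *\<^sub>R x0 + t *\<^sub>R x"
        have zh: "z = x0 + t *\<^sub>R (x - x0)" by (simp add: z_def algebra_simps)
        have "norm (t *\<^sub>R (x - x0)) = \<sigma>" using ne \<sigma>(1) by (simp add: t_def)
        then have "\<Phi> x0 (?y0 + k) w < \<Phi> z (?y0 + k) w" unfolding zh by (rule far)
        moreover have "\<Phi> z (?y0 + k) w \<le> (1 - t) * \<Phi> x0 (?y0 + k) w + t * \<Phi> x (?y0 + k) w"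
        proof -
          have "\<psi> z \<le> (1 - t) * \<psi> x0 + t * \<psi> x"
            using cvx xS x t unfolding z_def by (intro convex_onD) auto
          then have "(1 - s * w) * \<psi> z \<le> (1 - s * w) * ((1 - t) * \<psi> x0 + t * \<psi> x)"
            using sw by (intro mult_left_mono) auto
          moreover define Y where "Y = ?y0 + k"
          moreover have "z \<bullet> Y = (1 - t) * (x0 \<bullet> Y) + t * (x \<bullet> Y)"
            by (simp add: z_def inner_add_left)
          ultimately show ?thesis
            unfolding \<Phi>_def Y_def[symmetric] by (simp add: algebra_simps)
        qed
        moreover have "0 \<le> \<Phi> x0 (?y0 + k) w" using near[of 0] \<sigma>(1) by simp
        ultimately have "t * \<Phi> x0 (?y0 + k) w < t * \<Phi> x (?y0 + k) w" by (simp add: algebra_simps)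
        then have "\<Phi> x0 (?y0 + k) w < \<Phi> x (?y0 + k) w" using t(1) by simp
        then show ?thesis using \<open>0 \<le> \<Phi> x0 (?y0 + k) w\<close> by linarith
      qed
      have upper: "?y0 + k \<in> Sd" "\<eta> (?y0 + k) \<le> w"
        using D2[OF sw, of "?y0 + k"] \<Phi>_nonneg by (force simp: \<Phi>_def)+
      define w' where "w' = \<eta>0 + lin k + Q k / 2 + - (\<epsilon>' * N)"
      have "w' \<le> \<eta> (?y0 + k)"
      proof (rule ccontr)
        assume "\<not> w' \<le> \<eta> (?y0 + k)"
        then have lt: "\<eta> (?y0 + k) < w'" by simp
        \<comment> \<open>The point \<open>x0 + H k\<close> kills the completed square and violates the inequality \<open>D1\<close>.\<close>
        have nHk: "norm (H *v k) \<le> \<sigma>"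
        proof -
          have "norm k \<le> \<sigma> / (L + 1)" using k \<kappa>(3) by linarith
          then have "norm k * (L + 1) \<le> \<sigma>" using nn by (simp add: pos_le_divide_eq)
          moreover have "norm k * (L + 1) = L * norm k + norm k" by (simp add: algebra_simps)
          ultimately show ?thesis using nH[of k] norm_ge_zero[of k] by linarith
        qed
        have xk: "x0 + H *v k \<in> S" by (rule inS[OF nHk])
        have "0 \<le> \<Phi> (x0 + H *v k) (?y0 + k) (\<eta> (?y0 + k))"
          using D1[OF xk upper(1)] by (simp add: \<Phi>_def)
        also have "\<dots> < \<Phi> (x0 + H *v k) (?y0 + k) w'"
        proof -
          have "(1 - s * \<psi> (x0 + H *v k)) * \<eta> (?y0 + k) < (1 - s * \<psi> (x0 + H *v k)) * w'"
            using pos[OF xk] lt by (intro mult_strict_left_mono) auto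
          then show ?thesis by (simp add: \<Phi>_def algebra_simps)
        qed
        also have "\<dots> \<le> - (g * (\<epsilon>' * N)) + \<tau> * ((norm (H *v k))\<^sup>2 + N)"
          using est[of "H *v k" k "- (\<epsilon>' * N)"] nHk \<sigma>(2) k\<rho> eN(2)
          unfolding w'_def N_def[symmetric] by (simp add: abs_le_iff)
        also have "\<dots> \<le> 0"
        proof -
          have "(norm (H *v k))\<^sup>2 + N \<le> (2 * L\<^sup>2 + 1) * N"
          proof -
            have "(norm (H *v k))\<^sup>2 \<le> L\<^sup>2 * N" using nH2[of k] by (simp add: N_def)
            moreover have "0 \<le> L\<^sup>2 * N" using N0 by simp
            moreover have "(2 * L\<^sup>2 + 1) * N = 2 * (L\<^sup>2 * N) + N" by (simp add: distrib_right)
            ultimately show ?thesis by linarith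
          qed
          then have "\<tau> * ((norm (H *v k))\<^sup>2 + N) \<le> \<tau> * ((2 * L\<^sup>2 + 1) * N)"
            using \<tau>(1) by (intro mult_left_mono) auto
          also have "\<dots> \<le> g * \<epsilon>' * N" using mult_right_mono[OF \<tau>(3) N0] by (simp add: mult.assoc)
          finally show ?thesis by simp
        qed
        finally show False by simp
      qed
      moreover have "\<epsilon>' * N \<le> \<epsilon> * (norm k)\<^sup>2" using \<epsilon>'(3) by (auto simp: N_def intro: mult_right_mono)
      ultimately show ?thesis using upper by (auto simp: w_def w'_def abs_le_iff)
    qed
    then show ?thesis using \<kappa>(1) by blast
  qed
  obtain \<kappa> where \<kappa>: "\<kappa> > 0" "\<And>k. norm k < \<kappa> \<Longrightarrow> ?y0 + k \<in> Sd"
    "\<And>k. norm k < \<kappa> \<Longrightarrow> \<bar>\<eta> (?y0 + k) - \<eta>0 - lin k - Q k / 2\<bar> \<le> 1 * (norm k)\<^sup>2"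
    using main[of 1] by force
  have "ball ?y0 \<kappa> \<subseteq> Sd"
  proof
    fix y assume "y \<in> ball ?y0 \<kappa>"
    then show "y \<in> Sd" using \<kappa>(2)[of "y - ?y0"] by (simp add: dist_norm norm_minus_commute)
  qed
  then show "?y0 \<in> interior Sd" using \<kappa>(1) by (auto simp: mem_interior)
  have val: "\<eta> ?y0 = \<eta>0" using \<kappa>(3)[of 0] \<kappa>(1) by (simp add: lin_def Q_def)
  then show "\<eta> ?y0 = (x0 \<bullet> v - \<psi> x0) / m" by (simp add: \<eta>0_def)
  have "lin k = ((1 / g) *\<^sub>R x0) \<bullet> k" for k by (simp add: lin_def)
  then show "expands_at \<eta> ?y0 ((1 / g) *\<^sub>R x0) Md"
    unfolding expands_at_def using main by (simp add: val Q_def) blast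
qed

section \<open>Duality of s-concave functions\<close>

lemma one_minus_assoc_convex: "s > 0 \<Longrightarrow> 1 - s * assoc_convex s f x = f x powr s"
  by (simp add: assoc_convex_def)

lemma s_concaveD:
  assumes "s > 0" "s_concave s f" "f x > 0" "f y > 0" "0 \<le> t" "t \<le> 1"
  shows "f ((1 - t) *\<^sub>R x + t *\<^sub>R y) > 0"
    and "(1 - t) * f x powr s + t * f y powr s \<le> f ((1 - t) *\<^sub>R x + t *\<^sub>R y) powr s"
proof -
  define c where "c = (1 - t) * f x powr s + t * f y powr s"
  have c: "c > 0"
  proof (cases "t = 0")
    case False
    then have "t * f y powr s > 0" "(1 - t) * f x powr s \<ge> 0" using assms by auto
    then show ?thesis by (simp add: c_def)
  qed (use assms in \<open>simp add: c_def\<close>)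
  have le: "c powr (1 / s) \<le> f ((1 - t) *\<^sub>R x + t *\<^sub>R y)"
    using assms by (simp add: s_concave_def c_def)
  moreover have "c powr (1 / s) > 0" using c by simp
  ultimately show "f ((1 - t) *\<^sub>R x + t *\<^sub>R y) > 0" by linarith
  have "(c powr (1 / s)) powr s \<le> f ((1 - t) *\<^sub>R x + t *\<^sub>R y) powr s"
    using le assms(1) by (intro powr_mono2) auto
  then show "(1 - t) * f x powr s + t * f y powr s \<le> f ((1 - t) *\<^sub>R x + t *\<^sub>R y) powr s"
    using c assms(1) by (simp add: powr_powr c_def)
qed

lemma convex_on_assoc_convex:
  assumes s: "s > 0" and f: "s_concave s f"
  shows "convex_on (pos_set f) (assoc_convex s f)"
proof (rule convex_onI)
  show "convex (pos_set f)"
    unfolding convex_alt pos_set_def using s_concaveD(1)[OF s f] by auto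
  fix t x y assume t: "0 < t" "t < (1::real)" and xy: "x \<in> pos_set f" "y \<in> pos_set f"
  have "(1 - t) * f x powr s + t * f y powr s \<le> f ((1 - t) *\<^sub>R x + t *\<^sub>R y) powr s"
    using s_concaveD(2)[OF s f] t xy by (simp add: pos_set_def)
  then have "1 - f ((1 - t) *\<^sub>R x + t *\<^sub>R y) powr s \<le> (1 - t) * (1 - f x powr s) + t * (1 - f y powr s)"
    by (simp add: algebra_simps)
  then have "(1 - f ((1 - t) *\<^sub>R x + t *\<^sub>R y) powr s) / s
      \<le> ((1 - t) * (1 - f x powr s) + t * (1 - f y powr s)) / s"
    using s by (intro divide_right_mono) auto
  then show "assoc_convex s f ((1 - t) *\<^sub>R x + t *\<^sub>R y) \<le> (1 - t) * assoc_convex s f x + t * assoc_convex s f y"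
    by (simp add: assoc_convex_def add_divide_distrib)
qed

lemma legendre_dual_nonneg:
  assumes "pos_set f \<noteq> {}"
  shows "legendre_dual s f y \<ge> 0"
  unfolding legendre_dual_def using assms
  by (intro cINF_greatest) (auto simp: pos_set_def)

lemma legendre_dual_le:
  assumes "x \<in> pos_set f"
  shows "legendre_dual s f y \<le> max (1 - s * (x \<bullet> y)) 0 powr (1 / s) / f x"
  unfolding legendre_dual_def
  by (rule cINF_lower[OF bdd_belowI2[of _ 0] assms]) (auto simp: pos_set_def)

lemma powr_mult_legendre_dual_le:
  assumes s: "s > 0" and x: "x \<in> pos_set f" and y: "y \<in> pos_set (legendre_dual s f)"
  shows "f x powr s * legendre_dual s f y powr s \<le> 1 - s * (x \<bullet> y)"
proof -
  let ?d = "legendre_dual s f y" and ?a = "max (1 - s * (x \<bullet> y)) 0"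
  have fx: "f x > 0" and d: "?d > 0" using x y by (auto simp: pos_set_def)
  have "f x * ?d \<le> ?a powr (1 / s)"
    using legendre_dual_le[OF x, of s y] fx by (simp add: pos_le_divide_eq mult.commute)
  then have "(f x * ?d) powr s \<le> (?a powr (1 / s)) powr s"
    using s fx d by (intro powr_mono2) auto
  then have "f x powr s * ?d powr s \<le> ?a"
    using s fx d by (simp add: powr_mult powr_powr)
  moreover have "f x powr s * ?d powr s > 0" using fx d by simp
  ultimately show ?thesis by linarith
qed

text \<open>
  Together with the previous lemma this says that \<open>legendre_dual s f y powr s\<close> is the
  largest \<open>w\<close> with \<open>f x powr s * w \<le> 1 - s (x \<bullet> y)\<close> on the positivity set of \<open>f\<close>, as soon
  as some positive \<open>w\<close> satisfies this.
\<close>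

lemma le_legendre_dual:
  assumes s: "s > 0" and ne: "pos_set f \<noteq> {}" and w: "w > 0"
    and le: "\<And>x. x \<in> pos_set f \<Longrightarrow> f x powr s * w \<le> 1 - s * (x \<bullet> y)"
  shows "y \<in> pos_set (legendre_dual s f)" "w \<le> legendre_dual s f y powr s"
proof -
  have "w powr (1 / s) \<le> legendre_dual s f y"
    unfolding legendre_dual_def
  proof (rule cINF_greatest[OF ne])
    fix x assume x: "x \<in> pos_set f"
    then have fx: "f x > 0" by (simp add: pos_set_def)
    have "0 < f x powr s * w" using fx w by simp
    then have "max (1 - s * (x \<bullet> y)) 0 = 1 - s * (x \<bullet> y)" using le[OF x] by simp
    moreover have "(f x powr s * w) powr (1 / s) \<le> (1 - s * (x \<bullet> y)) powr (1 / s)"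
      using le[OF x] s w by (intro powr_mono2) auto
    ultimately show "w powr (1 / s) \<le> max (1 - s * (x \<bullet> y)) 0 powr (1 / s) / f x"
      using fx w s by (simp add: powr_mult powr_powr pos_le_divide_eq mult.commute)
  qed
  moreover have "w powr (1 / s) > 0" using w by simp
  ultimately have "legendre_dual s f y > 0" by linarith
  then show "y \<in> pos_set (legendre_dual s f)" by (simp add: pos_set_def)
  have "(w powr (1 / s)) powr s \<le> legendre_dual s f y powr s"
    using \<open>w powr (1 / s) \<le> _\<close> s by (intro powr_mono2) auto
  then show "w \<le> legendre_dual s f y powr s" using w s by (simp add: powr_powr)
qed

lemma s_concave_legendre_dual:
  assumes s: "s > 0" and ne: "pos_set f \<noteq> {}"
  shows "s_concave s (legendre_dual s f)"
  unfolding s_concave_def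
proof (intro allI ballI impI)
  fix y z t assume t: "t \<in> {0..1::real}" and pos: "legendre_dual s f y > 0" "legendre_dual s f z > 0"
  let ?d = "legendre_dual s f"
  define w where "w = (1 - t) * ?d y powr s + t * ?d z powr s"
  have w: "w > 0"
  proof (cases "t = 0")
    case False
    then have "t * ?d z powr s > 0" "(1 - t) * ?d y powr s \<ge> 0" using t pos by auto
    then show ?thesis by (simp add: w_def)
  qed (use pos in \<open>simp add: w_def\<close>)
  have le: "w \<le> ?d ((1 - t) *\<^sub>R y + t *\<^sub>R z) powr s" and
    mem: "(1 - t) *\<^sub>R y + t *\<^sub>R z \<in> pos_set ?d"
  proof -
    have "f x powr s * w \<le> 1 - s * (x \<bullet> ((1 - t) *\<^sub>R y + t *\<^sub>R z))" if x: "x \<in> pos_set f" for x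
    proof -
      have "(1 - t) * (f x powr s * ?d y powr s) + t * (f x powr s * ?d z powr s)
          \<le> (1 - t) * (1 - s * (x \<bullet> y)) + t * (1 - s * (x \<bullet> z))"
        using t pos by (intro add_mono mult_left_mono powr_mult_legendre_dual_le[OF s x]) (auto simp: pos_set_def)
      then show ?thesis by (simp add: w_def inner_add_right algebra_simps)
    qed
    then show "w \<le> ?d ((1 - t) *\<^sub>R y + t *\<^sub>R z) powr s" "(1 - t) *\<^sub>R y + t *\<^sub>R z \<in> pos_set ?d"
      using le_legendre_dual[OF s ne w] by auto
  qed
  have "w powr (1 / s) \<le> (?d ((1 - t) *\<^sub>R y + t *\<^sub>R z) powr s) powr (1 / s)"
    using le w s by (intro powr_mono2) auto
  then show "((1 - t) * ?d y powr s + t * ?d z powr s) powr (1 / s) \<le> ?d ((1 - t) *\<^sub>R y + t *\<^sub>R z)"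
    using s mem by (simp add: powr_powr w_def pos_set_def)
qed

text \<open>
  The inequality that concavity of \<open>f powr s\<close> gives on the segment from \<open>x\<close> to the origin
  when \<open>f 0 > 0\<close>. Unlike \<open>f 0 > 0\<close>, it passes to the dual, whose positivity set may leave
  out the origin.
\<close>

definition star_concave :: "real \<Rightarrow> ('a::real_vector \<Rightarrow> real) \<Rightarrow> bool" where
  "star_concave s f \<longleftrightarrow>
     (\<forall>x t. f x > 0 \<longrightarrow> 0 < t \<longrightarrow> t \<le> 1 \<longrightarrow> t * f x powr s \<le> f (t *\<^sub>R x) powr s)"

lemma s_concave_imp_star_concave:
  assumes "s > 0" "s_concave s f" "f 0 > 0"
  shows "star_concave s f"
  unfolding star_concave_def
proof (intro allI impI)
  fix x and t :: real assume "f x > 0" "0 < t" "t \<le> 1"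
  then have "(1 - t) * f 0 powr s + t * f x powr s \<le> f (t *\<^sub>R x) powr s"
    using s_concaveD(2)[OF assms(1,2) assms(3), of x t] by simp
  moreover have "(1 - t) * f 0 powr s \<ge> 0" using \<open>t \<le> 1\<close> by simp
  ultimately show "t * f x powr s \<le> f (t *\<^sub>R x) powr s" by linarith
qed

lemma star_concave_legendre_dual:
  assumes s: "s > 0" and ne: "pos_set f \<noteq> {}"
  shows "star_concave s (legendre_dual s f)"
  unfolding star_concave_def
proof (intro allI impI)
  fix y and t :: real assume y: "legendre_dual s f y > 0" and t: "0 < t" "t \<le> 1"
  show "t * legendre_dual s f y powr s \<le> legendre_dual s f (t *\<^sub>R y) powr s"
  proof (rule le_legendre_dual(2)[OF s ne])
    show "t * legendre_dual s f y powr s > 0" using y t by simp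
    fix x assume x: "x \<in> pos_set f"
    have "t * (f x powr s * legendre_dual s f y powr s) \<le> t * (1 - s * (x \<bullet> y))"
      using powr_mult_legendre_dual_le[OF s x] y t by (intro mult_left_mono) (auto simp: pos_set_def)
    then show "f x powr s * (t * legendre_dual s f y powr s) \<le> 1 - s * (x \<bullet> t *\<^sub>R y)"
      using t by (simp add: algebra_simps)
  qed
qed

section \<open>The bipolar theorem for the dual of an s-concave function\<close>

text \<open>
  The dual is polarity of the region below the graph of \<open>f powr s\<close>, restricted to the
  upper half-space. A point \<open>(x1, T)\<close> above the graph is separated from the closure of
  this region by a hyperplane; if its last coefficient \<open>w\<close> is positive, it gives a point
  of the dual at which \<open>x1\<close> violates the conjugate inequality. A hyperplane with \<open>w \<le> 0\<close>
  may be replaced by a vertical one and then be tilted towards any point at which the dual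
  is positive.
\<close>

lemma legendre_dual_legendre_dual:
  fixes f :: "'a::euclidean_space \<Rightarrow> real"
  assumes s: "s > 0" and nonneg: "\<And>x. f x \<ge> 0" and usc: "upper_semicontinuous f"
    and conc: "s_concave s f" and f0: "f 0 > 0" and ned: "pos_set (legendre_dual s f) \<noteq> {}"
  shows "legendre_dual s (legendre_dual s f) = f"
proof
  fix x1
  let ?d = "legendre_dual s f"
  have ne: "pos_set f \<noteq> {}" using f0 by (auto simp: pos_set_def)
  show "legendre_dual s ?d x1 = f x1"
  proof (rule antisym)
    show "f x1 \<le> legendre_dual s ?d x1"
    proof (cases "f x1 > 0")
      case True
      then have x1: "x1 \<in> pos_set f" by (simp add: pos_set_def)
      show ?thesis
        unfolding legendre_dual_def[of s ?d]
      proof (rule cINF_greatest[OF ned])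
        fix y assume y: "y \<in> pos_set ?d"
        then have d: "?d y > 0" by (simp add: pos_set_def)
        have le: "f x1 powr s * ?d y powr s \<le> 1 - s * (y \<bullet> x1)"
          using powr_mult_legendre_dual_le[OF s x1 y] by (simp add: inner_commute)
        then have "(f x1 powr s * ?d y powr s) powr (1 / s) \<le> max (1 - s * (y \<bullet> x1)) 0 powr (1 / s)"
          using s by (intro powr_mono2) auto
        then show "f x1 \<le> max (1 - s * (y \<bullet> x1)) 0 powr (1 / s) / ?d y"
          using True d s by (simp add: powr_mult powr_powr pos_le_divide_eq)
      qed
    next
      case False
      then show ?thesis using legendre_dual_nonneg[OF ned, of s x1] by linarith
    qed
    show "legendre_dual s ?d x1 \<le> f x1"
    proof (rule ccontr)
      assume "\<not> legendre_dual s ?d x1 \<le> f x1"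
      then have "f x1 < legendre_dual s ?d x1" by simp
      then obtain t1 where t1: "f x1 < t1" "t1 < legendre_dual s ?d x1" using dense by blast
      obtain t0 where t0: "f x1 < t0" "t0 < t1" using t1(1) dense by blast
      have t0p: "t0 > 0" and t1p: "t1 > 0" using t0 nonneg[of x1] by linarith+
      define T where "T = t1 powr s"
      have T: "T > 0" using t1p by (simp add: T_def)
      have no_separator: False
        if w: "w > 0" and le: "\<And>x. x \<in> pos_set f \<Longrightarrow> f x powr s * w \<le> 1 - s * (x \<bullet> y)"
          and ge: "1 \<le> s * (x1 \<bullet> y) + w * T" for y w
      proof -
        have y: "y \<in> pos_set ?d" "w \<le> ?d y powr s" using le_legendre_dual[OF s ne w le] by auto
        then have d: "?d y > 0" by (simp add: pos_set_def)
        have "max (1 - s * (y \<bullet> x1)) 0 \<le> ?d y powr s * T"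
        proof -
          have "w * T \<le> ?d y powr s * T" using y(2) T by (intro mult_right_mono) auto
          moreover have "w * T > 0" using w T by simp
          ultimately show ?thesis using ge by (simp add: inner_commute)
        qed
        then have "max (1 - s * (y \<bullet> x1)) 0 powr (1 / s) \<le> (?d y powr s * T) powr (1 / s)"
          using s by (intro powr_mono2) auto
        also have "\<dots> = ?d y * t1" using s d t1p by (simp add: T_def powr_mult powr_powr)
        finally have "max (1 - s * (y \<bullet> x1)) 0 powr (1 / s) / ?d y \<le> t1"
          using d by (simp add: pos_divide_le_eq mult.commute)
        then show False using legendre_dual_le[OF y(1), of s x1] t1(2) by linarith
      qed
      define C where "C = {(x, \<tau>). f x > 0 \<and> 0 < \<tau> \<and> \<tau> \<le> f x powr s}"
      have "convex C"
        unfolding convex_alt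
      proof (intro ballI allI impI)
        fix p q and u :: real assume p: "p \<in> C" and q: "q \<in> C" and u: "0 \<le> u \<and> u \<le> 1"
        obtain x \<tau> where p': "p = (x, \<tau>)" "f x > 0" "0 < \<tau>" "\<tau> \<le> f x powr s" using p by (auto simp: C_def)
        obtain x' \<tau>' where q': "q = (x', \<tau>')" "f x' > 0" "0 < \<tau>'" "\<tau>' \<le> f x' powr s" using q by (auto simp: C_def)
        have "(1 - u) * \<tau> + u * \<tau>' \<le> (1 - u) * f x powr s + u * f x' powr s"
          using p' q' u by (intro add_mono mult_left_mono) auto
        also have "\<dots> \<le> f ((1 - u) *\<^sub>R x + u *\<^sub>R x') powr s"
          using s_concaveD(2)[OF s conc] p' q' u by blast
        finally have "(1 - u) * \<tau> + u * \<tau>' \<le> f ((1 - u) *\<^sub>R x + u *\<^sub>R x') powr s" .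
        moreover have "(1 - u) * \<tau> + u * \<tau>' > 0"
        proof (cases "u = 0")
          case False
          then have "u * \<tau>' > 0" "(1 - u) * \<tau> \<ge> 0" using u p' q' by auto
          then show ?thesis by linarith
        qed (use p' in simp)
        ultimately show "(1 - u) *\<^sub>R p + u *\<^sub>R q \<in> C"
          using s_concaveD(1)[OF s conc, of x x' u] p' q' u by (simp add: C_def)
      qed
      \<comment> \<open>Upper semicontinuity keeps a point strictly above the graph away from the closure of \<open>C\<close>.\<close>
      have notin: "(x1, T) \<notin> closure C"
      proof -
        have "\<forall>\<^sub>F y in nhds x1. f y < t0" using usc t0(1) by (simp add: upper_semicontinuous_def)
        then obtain U where U: "open U" "x1 \<in> U" "\<And>y. y \<in> U \<Longrightarrow> f y < t0"
          by (auto simp: eventually_nhds)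
        have "open (U \<times> {t0 powr s<..})" using U(1) by (intro open_Times) auto
        moreover have "(x1, T) \<in> U \<times> {t0 powr s<..}"
          using U(2) t0(2) t0p s by (simp add: T_def powr_less_mono2)
        moreover have "U \<times> {t0 powr s<..} \<inter> C = {}"
        proof (rule ccontr)
          assume "U \<times> {t0 powr s<..} \<inter> C \<noteq> {}"
          then obtain x \<tau> where x: "x \<in> U" "t0 powr s < \<tau>" "f x > 0" "\<tau> \<le> f x powr s" by (auto simp: C_def)
          have "f x powr s \<le> t0 powr s" using U(3)[OF x(1)] x(3) s by (intro powr_mono2) auto
          then show False using x by linarith
        qed
        ultimately show ?thesis by (meson open_Int_closure_eq_empty disjoint_iff)
      qed
      obtain a b where ab: "inner a (x1, T) < b" "\<And>z. z \<in> closure C \<Longrightarrow> inner a z > b"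
        using separating_hyperplane_closed_point[OF convex_closure[OF \<open>convex C\<close>] closed_closure notin]
        by blast
      obtain \<alpha> \<omega> where a: "a = (\<alpha>, \<omega>)" by (cases a)
      have "(0, 0) \<in> closure C"
        unfolding closure_approachable
      proof (intro allI impI)
        fix e :: real assume "e > 0"
        then have "(0, min (e / 2) (f 0 powr s)) \<in> C" using f0 by (auto simp: C_def)
        moreover have "dist (0 :: 'a, min (e / 2) (f 0 powr s)) (0, 0) < e"
          using \<open>e > 0\<close> f0 by (simp add: dist_Pair_Pair)
        ultimately show "\<exists>y\<in>C. dist y (0, 0) < e" by blast
      qed
      from ab(2)[OF this] have b: "b < 0" by (simp add: a)
      define y where "y = (1 / (b * s)) *\<^sub>R \<alpha>"
      define w where "w = \<omega> / b"
      have scaled: "s * (x \<bullet> y) + w * \<tau> = inner a (x, \<tau>) / b" for x \<tau>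
        using b s by (simp add: y_def w_def a inner_commute add_divide_distrib)
      have above: "s * (x1 \<bullet> y) + w * T > 1"
        unfolding scaled using ab(1) b by (simp add: neg_less_divide_eq)
      have below: "s * (x \<bullet> y) + w * \<tau> \<le> 1" if "(x, \<tau>) \<in> C" for x \<tau>
        unfolding scaled using ab(2)[of "(x, \<tau>)"] closure_subset[of C] that b
        by (simp add: neg_divide_le_eq subset_iff less_imp_le)
      have C_top: "f x powr s * w \<le> 1 - s * (x \<bullet> y)" if "x \<in> pos_set f" for x
        using below[of x "f x powr s"] that by (simp add: C_def pos_set_def mult.commute)
      show False
      proof (cases "w > 0")
        case True
        then show False using no_separator[OF True C_top] above by simp
      next
        case False
        have C_base: "s * (x \<bullet> y) \<le> 1" if x: "x \<in> pos_set f" for x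
        proof (rule le_of_small_linear_le)
          show "f x powr s > 0" using x by (simp add: pos_set_def)
          fix t assume "0 < t" "t < f x powr s"
          then show "s * (x \<bullet> y) + t * w \<le> 1"
            using below[of x t] x by (simp add: C_def pos_set_def mult.commute)
        qed
        have "w * T \<le> 0" using False T by (simp add: mult_nonpos_nonneg)
        then have A: "s * (x1 \<bullet> y) > 1" using above by linarith
        obtain y2 where y2: "y2 \<in> pos_set ?d" using ned by blast
        define w2 where "w2 = ?d y2 powr s"
        have w2: "w2 > 0" using y2 by (simp add: w2_def pos_set_def)
        \<comment> \<open>The tilt is so small that \<open>x1\<close> stays beyond the hyperplane.\<close>
        define \<epsilon> where "\<epsilon> = min (1 / 2) ((s * (x1 \<bullet> y) - 1) / (\<bar>s * (x1 \<bullet> y2) - s * (x1 \<bullet> y)\<bar> + 1))"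
        have \<epsilon>: "0 < \<epsilon>" "\<epsilon> < 1" using A by (auto simp: \<epsilon>_def add_nonneg_pos)
        have \<epsilon>A: "\<epsilon> * (\<bar>s * (x1 \<bullet> y2) - s * (x1 \<bullet> y)\<bar> + 1) \<le> s * (x1 \<bullet> y) - 1"
        proof -
          have "\<epsilon> \<le> (s * (x1 \<bullet> y) - 1) / (\<bar>s * (x1 \<bullet> y2) - s * (x1 \<bullet> y)\<bar> + 1)" by (simp add: \<epsilon>_def)
          then show ?thesis by (simp add: pos_le_divide_eq add_nonneg_pos)
        qed
        show False
        proof (rule no_separator[of "\<epsilon> * w2" "(1 - \<epsilon>) *\<^sub>R y + \<epsilon> *\<^sub>R y2"])
          show "\<epsilon> * w2 > 0" using \<epsilon> w2 by simp
          show "f x powr s * (\<epsilon> * w2) \<le> 1 - s * (x \<bullet> ((1 - \<epsilon>) *\<^sub>R y + \<epsilon> *\<^sub>R y2))" if x: "x \<in> pos_set f" for x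
          proof -
            have "(1 - \<epsilon>) * (s * (x \<bullet> y)) \<le> (1 - \<epsilon>) * 1"
              using C_base[OF x] \<epsilon> by (intro mult_left_mono) auto
            moreover have "\<epsilon> * (f x powr s * w2) \<le> \<epsilon> * (1 - s * (x \<bullet> y2))"
              using powr_mult_legendre_dual_le[OF s x y2] \<epsilon> by (intro mult_left_mono) (auto simp: w2_def)
            ultimately show ?thesis by (simp add: inner_add_right algebra_simps)
          qed
          have "\<epsilon> * (s * (x1 \<bullet> y) - s * (x1 \<bullet> y2)) \<le> \<epsilon> * (\<bar>s * (x1 \<bullet> y2) - s * (x1 \<bullet> y)\<bar> + 1)"
            using \<epsilon> by (intro mult_left_mono) auto
          then have "1 \<le> s * (x1 \<bullet> ((1 - \<epsilon>) *\<^sub>R y + \<epsilon> *\<^sub>R y2))"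
            using \<epsilon>A by (simp add: inner_add_right algebra_simps)
          moreover have "\<epsilon> * w2 * T > 0" using \<epsilon> w2 T by simp
          ultimately show "1 \<le> s * (x1 \<bullet> ((1 - \<epsilon>) *\<^sub>R y + \<epsilon> *\<^sub>R y2)) + \<epsilon> * w2 * T" by linarith
        qed
      qed
    qed
  qed
qed

section \<open>The map to the dual point\<close>

text \<open>
  The conjugate inequality in additive form, for \<open>\<psi>\<close> and its dual, and in multiplicative
  form, for \<open>1 - s \<psi> = f powr s\<close>.
\<close>

lemma conjugate_inequality_iff:
  fixes a p q s :: real
  assumes "s > 0"
  shows "a + s * p * q \<le> p + q \<longleftrightarrow> (1 - s * p) * (1 - s * q) \<le> 1 - s * a"
proof -
  have "(1 - s * p) * (1 - s * q) \<le> 1 - s * a \<longleftrightarrow> s * (a + s * p * q) \<le> s * (p + q)"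
    by (simp add: algebra_simps)
  then show ?thesis using assms by simp
qed

lemma assoc_convex_legendre_dual_ineq:
  assumes s: "s > 0" and "x \<in> pos_set f" "y \<in> pos_set (legendre_dual s f)"
  shows "x \<bullet> y + s * assoc_convex s f x * assoc_convex s (legendre_dual s f) y
    \<le> assoc_convex s f x + assoc_convex s (legendre_dual s f) y"
  using powr_mult_legendre_dual_le[OF assms]
  by (simp add: conjugate_inequality_iff[OF s] one_minus_assoc_convex[OF s])

lemma assoc_convex_legendre_dual_least:
  assumes s: "s > 0" and ne: "pos_set f \<noteq> {}" and w: "s * w < 1"
    and le: "\<And>x. x \<in> pos_set f \<Longrightarrow> x \<bullet> y + s * assoc_convex s f x * w \<le> assoc_convex s f x + w"
  shows "y \<in> pos_set (legendre_dual s f) \<and> assoc_convex s (legendre_dual s f) y \<le> w"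
proof -
  have "1 - s * w > 0" using w by simp
  moreover have "f x powr s * (1 - s * w) \<le> 1 - s * (x \<bullet> y)" if "x \<in> pos_set f" for x
    using le[OF that] by (simp add: conjugate_inequality_iff[OF s] one_minus_assoc_convex[OF s])
  ultimately have "y \<in> pos_set (legendre_dual s f)" "1 - s * w \<le> legendre_dual s f y powr s"
    using le_legendre_dual[OF s ne] by blast+
  then show ?thesis using s by (simp add: assoc_convex_def pos_divide_le_eq mult.commute)
qed

text \<open>
  The determinant does not vanish on the segment from the identity to \<open>M\<close>.
\<close>

lemma det_pos_of_coercive:
  fixes M :: "real ^ 'n ^ 'n"
  assumes c: "c > 0" "\<And>h. c * (norm h)\<^sup>2 \<le> h \<bullet> (M *v h)"
  shows "det M > 0"
proof (rule ccontr)
  assume neg: "\<not> det M > 0"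
  define A where "A t = (1 - t) *\<^sub>R mat 1 + t *\<^sub>R M" for t :: real
  have ent: "A t $ i $ j = (1 - t) * mat 1 $ i $ j + t * M $ i $ j" for t i j
    by (simp add: A_def)
  have "continuous_on {0..1} (\<lambda>t. det (A t))"
    unfolding det_def ent by (intro continuous_intros)
  moreover have "det (A 1) \<le> 0" "0 \<le> det (A 0)" using neg by (simp_all add: A_def)
  ultimately obtain t where t: "0 \<le> t" "t \<le> 1" "det (A t) = 0"
    using IVT2'[of "\<lambda>t. det (A t)" 1 0 0] by auto
  then have "\<not> invertible (A t)" by (simp add: invertible_det_nz)
  then obtain h where h: "h \<noteq> 0" "A t *v h = 0"
    using matrix_left_invertible_ker[of "A t"] invertible_left_inverse[of "A t"] by blast
  have "h \<bullet> (A t *v h) = (1 - t) * (norm h)\<^sup>2 + t * (h \<bullet> (M *v h))"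
    by (simp add: A_def matrix_vector_mult_add_rdistrib scaleR_matrix_vector_assoc[symmetric]
        inner_add_right dot_square_norm)
  moreover have "t * (h \<bullet> (M *v h)) \<ge> t * (c * (norm h)\<^sup>2)" using c t by (intro mult_left_mono) auto
  moreover have "(1 - t) * (norm h)\<^sup>2 + t * (c * (norm h)\<^sup>2) > 0"
  proof (cases "t = 0")
    case False
    then have "t * (c * (norm h)\<^sup>2) > 0" "(1 - t) * (norm h)\<^sup>2 \<ge> 0" using t h c by auto
    then show ?thesis by linarith
  qed (use h in simp)
  ultimately show False using h(2) by simp
qed

text \<open>
  The value at the origin of the affine function tangent to \<open>1 - s \<psi>\<close> at \<open>x\<close>.
\<close>

definition support_value :: "real \<Rightarrow> ('a::real_inner \<Rightarrow> real) \<Rightarrow> 'a \<Rightarrow> real" where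
  "support_value s \<psi> x = 1 + s * (x \<bullet> gradient \<psi> x - \<psi> x)"

text \<open>
  The point \<open>y\<close> for which \<open>x\<close> attains the supremum that defines the dual function at \<open>y\<close>;
  geometrically, the pole of the hyperplane tangent to the graph of \<open>1 - s \<psi>\<close> over \<open>x\<close>.
\<close>

definition dual_point :: "real \<Rightarrow> ('a::real_inner \<Rightarrow> real) \<Rightarrow> 'a \<Rightarrow> 'a" where
  "dual_point s \<psi> x = (1 / support_value s \<psi> x) *\<^sub>R gradient \<psi> x"

text \<open>
  The derivative of \<open>dual_point s \<psi>\<close> obtained by formal differentiation, the Hessian
  serving as the derivative of the gradient.
\<close>

definition dual_jacobian :: "real \<Rightarrow> (real ^ 'n \<Rightarrow> real) \<Rightarrow> real ^ 'n \<Rightarrow> real ^ 'n ^ 'n" where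
  "dual_jacobian s \<psi> x = (1 / support_value s \<psi> x) *\<^sub>R
     ((mat 1 + outer (- (s / support_value s \<psi> x) *\<^sub>R gradient \<psi> x) x) ** hessian \<psi> x)"

text \<open>
  For concave \<open>f powr s\<close> with \<open>f 0 > 0\<close> this would need no curvature. In general the
  tangent at \<open>x\<close> has a nonnegative value at the origin, and a zero value would make
  \<open>f powr s\<close> linear on the segment to the origin, against the definiteness of \<open>M\<close>.
\<close>

lemma support_value_pos:
  fixes f :: "real ^ 'n \<Rightarrow> real"
  assumes s: "s > 0" and star: "star_concave s f" and fx: "f x > 0"
    and ex: "expands_at (assoc_convex s f) x v M" and c: "c > 0" "\<And>h. c * (norm h)\<^sup>2 \<le> h \<bullet> (M *v h)"
  shows "1 + s * (x \<bullet> v - assoc_convex s f x) > 0"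
proof -
  let ?\<psi> = "assoc_convex s f"
  have g: "1 - s * ?\<psi> x > 0" using fx by (simp add: one_minus_assoc_convex[OF s])
  show ?thesis
  proof (cases "x = 0")
    case True
    then show ?thesis using g by simp
  next
    case False
    define q where "q = x \<bullet> (M *v x)"
    have q: "q > 0"
    proof -
      have "0 < c * (norm x)\<^sup>2" using False c(1) by simp
      then show ?thesis using c(2)[of x] by (simp add: q_def)
    qed
    obtain \<tau> where \<tau>: "\<tau> > 0" "\<And>t. 0 < t \<Longrightarrow> t < \<tau> \<Longrightarrow>
       \<bar>?\<psi> (x + t *\<^sub>R (- x)) - ?\<psi> x - t * (v \<bullet> (- x)) - t\<^sup>2 * ((- x) \<bullet> (M *v (- x))) / 2\<bar> \<le> q / 4 * t\<^sup>2"
      using expands_at_along_ray[OF ex, of "q / 4" "- x"] q by auto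
    define t where "t = min (\<tau> / 2) (1 / 2)"
    have t: "0 < t" "t < \<tau>" "t < 1" using \<tau>(1) by (auto simp: t_def min_less_iff_disj)
    have "(1 - t) * (1 - s * ?\<psi> x) \<le> 1 - s * ?\<psi> ((1 - t) *\<^sub>R x)"
      using star fx t unfolding star_concave_def one_minus_assoc_convex[OF s] by simp
    then have "s * ?\<psi> ((1 - t) *\<^sub>R x) \<le> s * ?\<psi> x + t * (1 - s * ?\<psi> x)" by (simp add: algebra_simps)
    moreover have "?\<psi> x - t * (x \<bullet> v) + q / 4 * t\<^sup>2 \<le> ?\<psi> ((1 - t) *\<^sub>R x)"
    proof -
      have "x + t *\<^sub>R (- x) = (1 - t) *\<^sub>R x" by (simp add: algebra_simps)
      moreover have "(- x) \<bullet> (M *v (- x)) = q"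
        using matrix_vector_mult_diff_distrib[of M 0 x] by (simp add: q_def)
      ultimately have "\<bar>?\<psi> ((1 - t) *\<^sub>R x) - ?\<psi> x + t * (x \<bullet> v) - t\<^sup>2 * q / 2\<bar> \<le> q / 4 * t\<^sup>2"
        using \<tau>(2)[OF t(1,2)] by (simp add: inner_commute)
      from abs_le_D2[OF this] show ?thesis by (simp add: algebra_simps)
    qed
    then have "s * (?\<psi> x - t * (x \<bullet> v) + q / 4 * t\<^sup>2) \<le> s * ?\<psi> ((1 - t) *\<^sub>R x)"
      using s by (intro mult_left_mono) auto
    ultimately have "s * (q / 4) * t\<^sup>2 \<le> t * (1 + s * (x \<bullet> v - ?\<psi> x))"
      by (simp add: algebra_simps)
    moreover have "0 < s * (q / 4) * t\<^sup>2" using s q t by simp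
    ultimately have "0 < t * (1 + s * (x \<bullet> v - ?\<psi> x))" by linarith
    then show ?thesis using t(1) by (simp add: zero_less_mult_iff)
  qed
qed

lemma nondegenerate_pointE:
  fixes f :: "real ^ 'n \<Rightarrow> real"
  assumes s: "s > 0" and conc: "s_concave s f" and star: "star_concave s f"
    and x: "x \<in> nondegenerate_points (pos_set f) (assoc_convex s f)"
  obtains c where
    "expands_at (assoc_convex s f) x (gradient (assoc_convex s f) x) (hessian (assoc_convex s f) x)"
    "transpose (hessian (assoc_convex s f) x) = hessian (assoc_convex s f) x"
    "c > 0" "\<And>h. c * (norm h)\<^sup>2 \<le> h \<bullet> (hessian (assoc_convex s f) x *v h)"
    "x \<in> interior (pos_set f)" "0 < 1 - s * assoc_convex s f x" "0 < support_value s (assoc_convex s f) x"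
proof -
  let ?\<psi> = "assoc_convex s f"
  obtain M v where M: "expands_at ?\<psi> x v M" "transpose M = M" "invertible M"
    and int: "x \<in> interior (pos_set f)"
    using x unfolding nondegenerate_points_def has_alexandrov_hessian_iff by blast
  have gr: "gradient ?\<psi> x = v" and he: "hessian ?\<psi> x = M"
    using gradient_eq[OF M(1)] hessian_eq[OF M(1,2)] by auto
  have "0 \<le> h \<bullet> (M *v h)" for h
    by (rule convex_on_expands_at_psd[OF convex_on_assoc_convex[OF s conc] int M(1)])
  then obtain c where c: "c > 0" "\<And>h. c * (norm h)\<^sup>2 \<le> h \<bullet> (M *v h)"
    using psd_invertible_coercive[OF M(2) _ M(3)] by blast
  have fx: "f x > 0" using int interior_subset by (auto simp: pos_set_def)
  show thesis
  proof (rule that[of c])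
    show "0 < support_value s ?\<psi> x"
      unfolding support_value_def gr by (rule support_value_pos[OF s star fx M(1) c])
    show "0 < 1 - s * ?\<psi> x" using fx by (simp add: one_minus_assoc_convex[OF s])
  qed (use M c int gr he in auto)
qed

text \<open>
  The map to the dual point carries nondegenerate points to nondegenerate points of the
  dual and is inverted by the same construction for the dual. The quantities that enter
  the affine surface area transform explicitly.
\<close>

lemma dual_point_nondegenerate:
  fixes f :: "real ^ 'n \<Rightarrow> real" and s :: real
  defines "\<psi> \<equiv> assoc_convex s f" and "\<eta> \<equiv> assoc_convex s (legendre_dual s f)"
  assumes s: "s > 0" and conc: "s_concave s f" and star: "star_concave s f"
    and x: "x \<in> nondegenerate_points (pos_set f) \<psi>"
  shows "dual_point s \<psi> x \<in> nondegenerate_points (pos_set (legendre_dual s f)) \<eta>"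
    and "dual_point s \<eta> (dual_point s \<psi> x) = x"
    and "1 - s * \<eta> (dual_point s \<psi> x) = 1 / support_value s \<psi> x"
    and "support_value s \<eta> (dual_point s \<psi> x) = 1 / (1 - s * \<psi> x)"
    and "det (hessian \<eta> (dual_point s \<psi> x))
       = (support_value s \<psi> x / (1 - s * \<psi> x)) ^ (CARD('n) + 2) / det (hessian \<psi> x)"
    and "det (hessian \<psi> x) > 0"
proof -
  define v where "v = gradient \<psi> x"
  define M where "M = hessian \<psi> x"
  define g where "g = 1 - s * \<psi> x"
  define m where "m = support_value s \<psi> x"
  obtain c where ex: "expands_at \<psi> x v M" and sym: "transpose M = M"
    and c: "c > 0" "\<And>h. c * (norm h)\<^sup>2 \<le> h \<bullet> (M *v h)"
    and int: "x \<in> interior (pos_set f)" and g0: "g > 0" and m0: "m > 0"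
    using nondegenerate_pointE[OF s conc star x[unfolded \<psi>_def]]
    unfolding v_def M_def g_def m_def \<psi>_def by blast
  have ne: "pos_set f \<noteq> {}" using int interior_subset by blast
  have mg: "m = g + s * (x \<bullet> v)" by (simp add: m_def support_value_def g_def v_def algebra_simps)
  show D: "det (hessian \<psi> x) > 0" using det_pos_of_coercive[OF c] by (simp add: M_def)
  then have D0: "det M > 0" by (simp add: M_def)
  then have invM: "invertible M" by (simp add: invertible_det_nz)
  define N where "N = mat 1 + outer ((s / g) *\<^sub>R v) x"
  obtain Mi where Mi: "M ** Mi = mat 1" using invM unfolding invertible_def by blast
  define H where "H = m *\<^sub>R (Mi ** N)"
  define Md where "Md = (1 / (m * g)) *\<^sub>R (transpose H ** M ** H)"
  have N: "N *v k = k + (s / g * (x \<bullet> k)) *\<^sub>R v" for k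
    by (simp add: N_def matrix_vector_mult_add_rdistrib outer_mult_vec mult.commute)
  have HM: "M *v (H *v k) = m *\<^sub>R (k + (s / g * (x \<bullet> k)) *\<^sub>R v)" for k
  proof -
    have "M *v (Mi *v (N *v k)) = N *v k" by (simp only: matrix_vector_mul_assoc matrix_mul_assoc Mi matrix_mul_lid)
    then show ?thesis
      by (simp add: H_def scaleR_matrix_vector_assoc[symmetric] matrix_vector_mult_scaleR N
          matrix_vector_mul_assoc[symmetric])
  qed
  have Md_form: "m * g * (k \<bullet> (Md *v k)) = (H *v k) \<bullet> (M *v (H *v k))" for k
  proof -
    have "k \<bullet> ((transpose H ** M ** H) *v k) = (H *v k) \<bullet> (M *v (H *v k))"
      by (simp only: matrix_vector_mul_assoc[symmetric])
        (metis dot_lmul_matrix inner_commute transpose_matrix_vector)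
    then show ?thesis using m0 g0 by (simp add: Md_def scaleR_matrix_vector_assoc[symmetric])
  qed
  have symd: "transpose Md = Md"
    by (simp add: Md_def transpose_scalar matrix_transpose_mul sym matrix_mul_assoc)
  have detN: "det N = m / g"
    using g0 by (simp add: N_def det_rank_one_update mg add_divide_distrib inner_commute)
  have detH: "det H = m ^ CARD('n) * (m / g) / det M"
  proof -
    have "det M * det Mi = 1" using Mi by (metis det_I det_mul)
    then have "det Mi = 1 / det M" using D0 by (simp add: field_simps)
    then show ?thesis by (simp add: H_def det_scaleR det_mul detN)
  qed
  have detMd: "det Md = (m / g) ^ (CARD('n) + 2) / det M"
    using m0 g0 D0
    by (simp add: Md_def det_scaleR det_mul detH power_add power_divide power_mult_distrib
        power2_eq_square field_simps)
  have y: "dual_point s \<psi> x = (1 / m) *\<^sub>R v" by (simp add: dual_point_def m_def v_def)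
  note dual = dual_expands_at[where \<psi> = \<psi> and \<eta> = \<eta> and S = "pos_set f" and Sd = "pos_set (legendre_dual s f)",
      OF s convex_on_assoc_convex[OF s conc, folded \<psi>_def] _ _ _ int ex sym c g_def mg m0 HM Md_form]
  have dual: "(1 / m) *\<^sub>R v \<in> interior (pos_set (legendre_dual s f))"
    "\<eta> ((1 / m) *\<^sub>R v) = (x \<bullet> v - \<psi> x) / m"
    "expands_at \<eta> ((1 / m) *\<^sub>R v) ((1 / g) *\<^sub>R x) Md"
  proof -
    have 1: "s * \<psi> z < 1" if "z \<in> pos_set f" for z
    proof -
      have "1 - s * \<psi> z > 0" using that by (simp add: \<psi>_def one_minus_assoc_convex[OF s] pos_set_def)
      then show ?thesis by simp
    qed
    note * = 1 assoc_convex_legendre_dual_ineq[OF s, of _ f, folded \<psi>_def \<eta>_def]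
      assoc_convex_legendre_dual_least[OF s ne, folded \<psi>_def \<eta>_def]
    show "(1 / m) *\<^sub>R v \<in> interior (pos_set (legendre_dual s f))"
      "\<eta> ((1 / m) *\<^sub>R v) = (x \<bullet> v - \<psi> x) / m"
      "expands_at \<eta> ((1 / m) *\<^sub>R v) ((1 / g) *\<^sub>R x) Md"
      using dual[OF *] by blast+
  qed
  have grad: "gradient \<eta> ((1 / m) *\<^sub>R v) = (1 / g) *\<^sub>R x" using dual(3) by (rule gradient_eq)
  have hess: "hessian \<eta> ((1 / m) *\<^sub>R v) = Md" using dual(3) symd by (rule hessian_eq)
  have "invertible Md" using m0 g0 D0 by (simp add: invertible_det_nz detMd)
  then show "dual_point s \<psi> x \<in> nondegenerate_points (pos_set (legendre_dual s f)) \<eta>"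
    unfolding nondegenerate_points_def has_alexandrov_hessian_iff y using dual symd by blast
  show val: "1 - s * \<eta> (dual_point s \<psi> x) = 1 / support_value s \<psi> x"
    unfolding y dual(2) m_def[symmetric] using m0 by (simp add: field_simps) (simp add: mg g_def algebra_simps)
  have sv: "support_value s \<eta> (dual_point s \<psi> x) = 1 / g"
  proof -
    have "support_value s \<eta> (dual_point s \<psi> x)
        = (1 - s * \<eta> (dual_point s \<psi> x)) + s * (((1 / m) *\<^sub>R v) \<bullet> ((1 / g) *\<^sub>R x))"
      unfolding support_value_def y grad by (simp add: algebra_simps)
    also have "\<dots> = 1 / m + s * (x \<bullet> v) / (m * g)"
      by (simp add: val m_def[symmetric] inner_commute)
    also have "\<dots> = (g + s * (x \<bullet> v)) / (m * g)" using g0 by (simp add: add_divide_distrib)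
    also have "\<dots> = 1 / g" using m0 by (simp add: mg[symmetric])
    finally show ?thesis .
  qed
  then show "support_value s \<eta> (dual_point s \<psi> x) = 1 / (1 - s * \<psi> x)" by (simp add: g_def)
  show "dual_point s \<eta> (dual_point s \<psi> x) = x"
    using g0 unfolding dual_point_def[of s \<eta>] sv by (simp add: y grad)
  show "det (hessian \<eta> (dual_point s \<psi> x)) = (support_value s \<psi> x / (1 - s * \<psi> x)) ^ (CARD('n) + 2) / det (hessian \<psi> x)"
    unfolding y hess detMd by (simp add: m_def g_def M_def)
qed

lemma dual_point_has_derivative:
  fixes f :: "real ^ 'n \<Rightarrow> real" and s :: real
  defines "\<psi> \<equiv> assoc_convex s f"
  assumes s: "s > 0" and conc: "s_concave s f" and star: "star_concave s f"
    and x: "x \<in> nondegenerate_points (pos_set f) \<psi>"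
  shows "(dual_point s \<psi> has_derivative (\<lambda>h. dual_jacobian s \<psi> x *v h))
      (at x within nondegenerate_points (pos_set f) \<psi>)"
    and "det (dual_jacobian s \<psi> x) = (1 - s * \<psi> x) * det (hessian \<psi> x) / support_value s \<psi> x ^ (CARD('n) + 1)"
proof -
  let ?X = "nondegenerate_points (pos_set f) \<psi>"
  define p where "p = gradient \<psi>"
  define M where "M = hessian \<psi> x"
  define m where "m = support_value s \<psi> x"
  obtain c where ex: "expands_at \<psi> x (p x) M" and sym: "transpose M = M"
    and int: "x \<in> interior (pos_set f)" and g0: "1 - s * \<psi> x > 0" and m0: "m > 0"
    using nondegenerate_pointE[OF s conc star x[unfolded \<psi>_def]]
    unfolding p_def M_def m_def \<psi>_def by blast
  have cvx: "convex_on (pos_set f) \<psi>" unfolding \<psi>_def by (rule convex_on_assoc_convex[OF s conc])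
  have sub: "\<psi> z + p z \<bullet> (z' - z) \<le> \<psi> z'" if "z \<in> ?X" "z' \<in> pos_set f" for z z'
  proof -
    have "expands_at \<psi> z (p z) (hessian \<psi> z)" "z \<in> interior (pos_set f)"
      using nondegenerate_pointE[OF s conc star that(1)[unfolded \<psi>_def]] unfolding p_def \<psi>_def by blast+
    then show ?thesis using convex_on_ge_tangent[OF cvx _ that(2)] interior_subset by blast
  qed
  have dp: "(p has_derivative (\<lambda>h. M *v h)) (at x within ?X)"
    by (rule has_derivative_subgradient[OF int ex sym sub])
  have d\<psi>: "(\<psi> has_derivative (\<lambda>h. h \<bullet> p x)) (at x within ?X)"
    using expands_at_imp_GDERIV[OF ex] unfolding gderiv_def by (rule has_derivative_at_withinI)
  have dm: "(support_value s \<psi> has_derivative (\<lambda>h. s * (x \<bullet> (M *v h)))) (at x within ?X)"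
  proof -
    have "((\<lambda>z. 1 + s * (z \<bullet> p z - \<psi> z)) has_derivative (\<lambda>h. s * (x \<bullet> (M *v h)))) (at x within ?X)"
      by (auto intro!: derivative_eq_intros dp d\<psi>)
    then show ?thesis unfolding support_value_def p_def .
  qed
  have "((\<lambda>z. inverse (support_value s \<psi> z) *\<^sub>R p z) has_derivative (\<lambda>h. dual_jacobian s \<psi> x *v h)) (at x within ?X)"
  proof -
    have "((\<lambda>z. inverse (support_value s \<psi> z) *\<^sub>R p z) has_derivative
        (\<lambda>h. inverse m *\<^sub>R (M *v h) + (- (inverse m * (s * (x \<bullet> (M *v h))) * inverse m)) *\<^sub>R p x)) (at x within ?X)"
      using m0 by (auto intro!: derivative_eq_intros dp dm simp: m_def)
    moreover have "dual_jacobian s \<psi> x *v h =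
        inverse m *\<^sub>R (M *v h) + (- (inverse m * (s * (x \<bullet> (M *v h))) * inverse m)) *\<^sub>R p x" for h
      by (simp add: dual_jacobian_def m_def[symmetric] M_def[symmetric] p_def[symmetric]
          scaleR_matrix_vector_assoc[symmetric] matrix_vector_mul_assoc[symmetric]
          matrix_vector_mult_add_rdistrib outer_mult_vec divide_inverse algebra_simps)
    ultimately show ?thesis by simp
  qed
  then show "(dual_point s \<psi> has_derivative (\<lambda>h. dual_jacobian s \<psi> x *v h)) (at x within ?X)"
    unfolding dual_point_def p_def by (simp add: divide_inverse)
  have "1 + (- (s / m) *\<^sub>R p x) \<bullet> x = (1 - s * \<psi> x) / m"
  proof -
    have "m = 1 - s * \<psi> x + s * (p x \<bullet> x)"
      by (simp add: m_def support_value_def p_def inner_commute algebra_simps)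
    then show ?thesis using m0 by (simp add: field_simps)
  qed
  then show "det (dual_jacobian s \<psi> x) = (1 - s * \<psi> x) * det (hessian \<psi> x) / support_value s \<psi> x ^ (CARD('n) + 1)"
    unfolding dual_jacobian_def m_def[symmetric] p_def[symmetric] M_def[symmetric] det_scaleR det_mul det_rank_one_update
    by (simp add: power_divide)
qed

section \<open>Invariance of the affine surface area\<close>

text \<open>
  The integrand of the affine surface area.
\<close>

definition surface_density :: "real \<Rightarrow> real \<Rightarrow> (real ^ 'n \<Rightarrow> real) \<Rightarrow> real ^ 'n \<Rightarrow> real" where
  "surface_density s l \<psi> x =
     (1 - s * \<psi> x) powr ((1 / s - 1) * (1 - l)) * det (hessian \<psi> x) powr l /
       support_value s \<psi> x powr (l * (real CARD('n) + 1 / s + 1) - 1)"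

lemma affine_surface_area_eq_density:
  fixes \<psi> :: "real ^ 'n \<Rightarrow> real"
  shows "affine_surface_area s l S \<psi> = ennreal (1 / (1 + real CARD('n) * s)) *
     (\<integral>\<^sup>+x. ennreal (surface_density s l \<psi> x) * indicator (nondegenerate_points S \<psi>) x \<partial>lebesgue)"
  by (simp add: affine_surface_area_def surface_density_def support_value_def)

text \<open>
  Transformation of the density, with \<open>g = 1 - s \<psi> x\<close>, support value \<open>m\<close> and Hessian
  determinant \<open>D\<close>; the last factor is the Jacobian determinant of the dual point map. In
  logarithms it is a linear identity.
\<close>

lemma density_exponents:
  fixes g m D s l :: real
  assumes "s > 0" "g > 0" "m > 0" "D > 0"
  shows "g powr ((1 / s - 1) * (1 - l)) * D powr l / m powr (l * (real n + 1 / s + 1) - 1)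
    = ((1 / m) powr ((1 / s - 1) * (1 - (1 - l))) * ((m / g) ^ (n + 2) / D) powr (1 - l)
        / (1 / g) powr ((1 - l) * (real n + 1 / s + 1) - 1)) * (g * D / m ^ (n + 1))"
proof -
  obtain a where a: "g = exp a" using assms by (metis exp_ln)
  obtain b where b: "m = exp b" using assms by (metis exp_ln)
  obtain d where d: "D = exp d" using assms by (metis exp_ln)
  have 1: "1 / exp b = exp (- b)" "1 / exp a = exp (- a)" by (simp_all add: exp_minus divide_inverse)
  have 2: "exp b / exp a = exp (b - a)" by (simp add: exp_diff)
  have 3: "exp z ^ k = exp (real k * z)" for z k by (simp add: exp_of_nat_mult)
  have 4: "exp z powr r = exp (r * z)" for z r :: real by (simp add: powr_def)
  have "(1 / s - 1) * (1 - l) * a + l * d - (l * (real n + 1 / s + 1) - 1) * b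
      = (1 / s - 1) * (1 - (1 - l)) * (- b) + (1 - l) * (real (n + 2) * (b - a) - d)
        - ((1 - l) * (real n + 1 / s + 1) - 1) * (- a) + (a + d - real (n + 1) * b)"
    by (simp add: algebra_simps diff_divide_distrib)
  then show ?thesis
    unfolding a b d 1 2 3 4 exp_diff[symmetric] exp_add[symmetric] by simp
qed

lemma reciprocal_jacobians:
  fixes g m D :: real
  assumes "g > 0" "m > 0" "D > 0"
  shows "(g * D / m ^ (n + 1)) * (1 / m * ((m / g) ^ (n + 2) / D) / (1 / g) ^ (n + 1)) = 1"
  using assms by (simp add: power_divide field_simps)

lemma affine_surface_area_cong:
  fixes \<psi> \<phi> :: "real ^ 'n \<Rightarrow> real"
  assumes eq: "\<And>x. x \<in> S \<Longrightarrow> \<phi> x = \<psi> x"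
  shows "affine_surface_area s l S \<phi> = affine_surface_area s l S \<psi>"
proof -
  have eq': "\<phi> z = \<psi> z" if "z \<in> interior S" for z using eq that interior_subset by blast
  have ex: "expands_at \<phi> x v M \<longleftrightarrow> expands_at \<psi> x v M" if "x \<in> interior S" for x v M
    using expands_at_cong[OF _ open_interior that, of \<phi> v M \<psi>] eq'
      expands_at_cong[OF _ open_interior that, of \<psi> v M \<phi>] by auto
  have X: "nondegenerate_points S \<phi> = nondegenerate_points S \<psi>"
    unfolding nondegenerate_points_def has_alexandrov_hessian_iff using ex by blast
  have "surface_density s l \<phi> x = surface_density s l \<psi> x" if x: "x \<in> nondegenerate_points S \<phi>" for x
  proof -
    obtain v M where M: "expands_at \<phi> x v M" "transpose M = M" "x \<in> interior S"
      using x unfolding nondegenerate_points_def has_alexandrov_hessian_iff by blast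
    then have M': "expands_at \<psi> x v M" using ex by blast
    have "gradient \<phi> x = gradient \<psi> x" using gradient_eq[OF M(1)] gradient_eq[OF M'] by simp
    moreover have "hessian \<phi> x = hessian \<psi> x"
      using hessian_eq[OF M(1,2)] hessian_eq[OF M' M(2)] by simp
    ultimately show ?thesis using eq'[OF M(3)] by (simp add: surface_density_def support_value_def)
  qed
  then have "(\<integral>\<^sup>+x. ennreal (surface_density s l \<phi> x) * indicator (nondegenerate_points S \<phi>) x \<partial>lebesgue)
    = (\<integral>\<^sup>+x. ennreal (surface_density s l \<psi> x) * indicator (nondegenerate_points S \<psi>) x \<partial>lebesgue)"
    by (intro nn_integral_cong) (simp add: X split: split_indicator)
  then show ?thesis unfolding affine_surface_area_eq_density by simp
qed

text \<open>
  The bipolar theorem makes the situation symmetric, so the map to the dual point is a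
  bijection of the nondegenerate points. It is invoked only if the dual is positive
  somewhere; otherwise both sets of nondegenerate points are empty.
\<close>

lemma affine_surface_area_legendre_dual:
  fixes f :: "real ^ 'n \<Rightarrow> real"
  assumes s: "s > 0" and nonneg: "\<And>x. f x \<ge> 0" and usc: "upper_semicontinuous f"
    and conc: "s_concave s f" and f0: "f 0 > 0"
  shows "affine_surface_area s (1 - l) (pos_set (legendre_dual s f)) (assoc_convex s (legendre_dual s f))
    = affine_surface_area s l (pos_set f) (assoc_convex s f)"
proof -
  define d where "d = legendre_dual s f"
  define \<psi> where "\<psi> = assoc_convex s f"
  define \<eta> where "\<eta> = assoc_convex s d"
  define X where "X = nondegenerate_points (pos_set f) \<psi>"
  define Y where "Y = nondegenerate_points (pos_set d) \<eta>"
  have ne: "pos_set f \<noteq> {}" using f0 by (auto simp: pos_set_def)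
  have star: "star_concave s f" by (rule s_concave_imp_star_concave[OF s conc f0])
  have concd: "s_concave s d" unfolding d_def by (rule s_concave_legendre_dual[OF s ne])
  have stard: "star_concave s d" unfolding d_def by (rule star_concave_legendre_dual[OF s ne])
  note T = dual_point_nondegenerate[OF s conc star, folded d_def, folded \<psi>_def \<eta>_def, folded X_def Y_def]
  note dT = dual_point_has_derivative[OF s conc star, folded \<psi>_def, folded X_def]
  note dU = dual_point_has_derivative[OF s concd stard, folded \<eta>_def, folded Y_def]
  have U: "dual_point s \<eta> y \<in> X" "dual_point s \<psi> (dual_point s \<eta> y) = y" if y: "y \<in> Y" for y
  proof -
    have "pos_set d \<noteq> {}" using y interior_subset unfolding Y_def nondegenerate_points_def by blast
    then have dd: "legendre_dual s d = f"
      using legendre_dual_legendre_dual[OF s nonneg usc conc f0] by (simp add: d_def)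
    show "dual_point s \<eta> y \<in> X" "dual_point s \<psi> (dual_point s \<eta> y) = y"
      using dual_point_nondegenerate(1,2)[OF s concd stard, unfolded dd, folded \<psi>_def \<eta>_def, folded X_def Y_def, OF y]
      by auto
  qed
  have pos: "1 - s * \<psi> x > 0" "support_value s \<psi> x > 0" if "x \<in> X" for x
    using nondegenerate_pointE[OF s conc star that[unfolded X_def \<psi>_def]] unfolding \<psi>_def by blast+
  have jac: "det (dual_jacobian s \<psi> x) > 0" if x: "x \<in> X" for x
    using dT(2)[OF x] pos[OF x] T(6)[OF x] by simp
  have "(\<integral>\<^sup>+x. ennreal (surface_density s l \<psi> x) * indicator X x \<partial>lebesgue)
      = (\<integral>\<^sup>+y. ennreal (surface_density s (1 - l) \<eta> y) * indicator Y y \<partial>lebesgue)"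
  proof (rule nn_integral_change_of_variables[OF dT(1) dU(1) T(1) T(2) U])
    fix x assume x: "x \<in> X"
    let ?y = "dual_point s \<psi> x" and ?g = "1 - s * \<psi> x" and ?m = "support_value s \<psi> x" and ?D = "det (hessian \<psi> x)"
    note p = pos[OF x] T(6)[OF x]
    show "det (matrix (\<lambda>h. dual_jacobian s \<psi> x *v h)) * det (matrix (\<lambda>h. dual_jacobian s \<eta> ?y *v h)) = 1"
      unfolding matrix_of_matrix_vector_mul dT(2)[OF x] dU(2)[OF T(1)[OF x]] T(3-5)[OF x]
      by (rule reciprocal_jacobians[OF p])
    have "surface_density s l \<psi> x = surface_density s (1 - l) \<eta> ?y * det (dual_jacobian s \<psi> x)"
      unfolding surface_density_def dT(2)[OF x] T(3-5)[OF x] by (rule density_exponents[OF s p])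
    moreover have "surface_density s (1 - l) \<eta> ?y \<ge> 0"
      by (simp add: surface_density_def)
    ultimately show "ennreal (surface_density s l \<psi> x)
        = ennreal (surface_density s (1 - l) \<eta> ?y) * ennreal \<bar>det (matrix (\<lambda>h. dual_jacobian s \<psi> x *v h))\<bar>"
      unfolding matrix_of_matrix_vector_mul using jac[OF x] by (simp add: ennreal_mult)
  qed
  then show ?thesis
    unfolding affine_surface_area_eq_density d_def[symmetric] \<psi>_def[symmetric] \<eta>_def[symmetric]
      X_def[symmetric] Y_def[symmetric] by simp
qed

theorem theorem4:
  fixes f :: "real ^ 'n \<Rightarrow> real" and s lam :: real
  assumes "s > 0"
    and "\<And>x. f x \<ge> 0"
    and "upper_semicontinuous f"
    and "s_concave s f"
    and "0 \<in> interior (pos_set f)"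
  shows "affine_surface_area s (1 - lam) (pos_set (legendre_dual s f))
           (\<lambda>y. real_of_ereal (s_dual s (pos_set f) (assoc_convex s f) y))
         = affine_surface_area s lam (pos_set f) (assoc_convex s f)"
proof -
  have f0: "f 0 > 0" using assms(5) interior_subset by (auto simp: pos_set_def)
  then have ne: "pos_set f \<noteq> {}" by (auto simp: pos_set_def)
  have "affine_surface_area s (1 - lam) (pos_set (legendre_dual s f))
           (\<lambda>y. real_of_ereal (s_dual s (pos_set f) (assoc_convex s f) y))
      = affine_surface_area s (1 - lam) (pos_set (legendre_dual s f)) (assoc_convex s (legendre_dual s f))"
  proof (rule affine_surface_area_cong)
    fix y assume "y \<in> pos_set (legendre_dual s f)"
    then have "legendre_dual s f y > 0" by (simp add: pos_set_def)
    from s_dual_real_of_legendre_dual_pos[OF assms(1) ne this]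
    show "real_of_ereal (s_dual s (pos_set f) (assoc_convex s f) y) = assoc_convex s (legendre_dual s f) y"
      by simp
  qed
  also have "\<dots> = affine_surface_area s lam (pos_set f) (assoc_convex s f)"
    using assms f0 by (intro affine_surface_area_legendre_dual) auto
  finally show ?thesis .
qed

end
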